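(* Let $\widetilde{\mathfrak{A}}$ be an algorithm, $\delta\in(0,1)$ and $C\in\mathbb{R}$ a constant such that, with probability at least $1-\delta$, for any $T\ge1$, $R_T(\widetilde{\mathfrak{A}})\le\widetilde{O}(C\sqrt{T})$. Suppose that $\widetilde{\mathfrak{A}}$, selecting policies $\pi_1,\pi_2,\dots$, computes lower confidence bounds $\lambda_t^{\pi_k}$ ($k\le t$) on the values $V^{\pi_k}$ such that, with probability at least $1-\delta$, $\sum_{k=1}^{t}\big(V^{\pi_k}-\lambda_t^{\pi_k}\big)\le\widetilde{O}(C\sqrt{t})$ for every $t\ge1$. Then for any $T\ge1$, the regret over $T$ episodes of the algorithm \textsf{LCBCE} (defined in the context) run with $\widetilde{\mathfrak{A}}$ is bounded, with probability at least $1-\delta$, by $$\widetilde{O}\Big(C\sqrt{T}+\frac{C^2\Delta_0}{\alpha V^{\pi_0}(\alpha V^{\pi_0}+\Delta_0)}\Big).$$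
   Context: Setting. The environment is an unknown finite-horizon time-inhomogeneous MDP with state space $\mathcal{S}$, action space $\mathcal{A}$, horizon $H$, initial state $s_1$, transition kernels $p_h(\cdot\mid s,a)$ and random rewards with mean $r_h(s,a)$ for $h\in[H]$ (this includes bandits as the case $H=1$). A policy $\pi$ is a collection of maps $\pi_h:\mathcal{S}\to\Delta(\mathcal{A})$, $h\in[H]$, where $\Delta(\mathcal{A})$ is the set of probability distributions on $\mathcal{A}$. Its value is $V^\pi=\mathbb{E}[\sum_{h=1}^H r_h\mid s_1,\pi]$, and $V^\star=\max_\pi V^\pi$. At each episode $t=1,2,\dots$ an algorithm selects a policy $\pi_t$ based on past observations and observes a trajectory generated by $\pi_t$. The (pseudo-)regret of an algorithm $\mathfrak{A}$ selecting $\pi_1,\pi_2,\dots$ is $R_T(\mathfrak{A})=\sum_{t=1}^T(V^\star-V^{\pi_t})$. Baseline. $\pi_0$ is a given baseline policy with known value $V^{\pi_0}$ (with $\alpha V^{\pi_0}>0$), $\alpha\in(0,1)$ is the conservative level, and $\Delta_0=V^\star-V^{\pi_0}$ is the sub-optimality gap of $\pi_0$ (not known to the algorithm). Lower confidence bounds. The algorithm $\widetilde{\mathfrak{A}}$, selecting $\pi_1,\pi_2,\dots$, computes for each time $t$ real numbers $(\lambda_t^{\pi_k})_{k\le t}=(\lambda_t^{\pi_k}(\delta))_{k\le t}$ such that, with probability at least $1-\delta$, $\lambda_t^{\pi_k}\le V^{\pi_k}$ for all $k\le t$. (At time $t$, the policy $\pi_t$ and the numbers $\lambda_t^{\pi_k}$,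 $k\le t$, are computed from the observations of the first $t-1$ episodes of $\widetilde{\mathfrak{A}}$.) Algorithm \textsf{LCBCE} (Lower Confidence Bound for Conservative Exploration). Inputs: $\widetilde{\mathfrak{A}}$, $\delta$, its lower confidence bounds, $V^{\pi_0}$, $\alpha$. Initialize $B=0$ (accumulated budget) and $t'=0$ (number of episodes in which $\widetilde{\mathfrak{A}}$ was followed). For $t=1,\dots,T$: $\widetilde{\mathfrak{A}}$ provides its next policy $\tilde\pi_{t'+1}$ and the lower bounds $\lambda_{t'+1}^{\tilde\pi_k}$, $k\le t'+1$; set $\lambda=\sum_{k=1}^{t'+1}\lambda_{t'+1}^{\tilde\pi_k}$. If $(t'+1)(1-\alpha)V^{\pi_0}-\lambda>B$, play $\pi_0$ and set $B\leftarrow B+\alpha V^{\pi_0}$. Otherwise play $\tilde\pi_{t'+1}$, feed the observed trajectory to $\widetilde{\mathfrak{A}}$, and set $t'\leftarrow t'+1$. $\widetilde{O}(\cdot)$ is big-O notation hiding logarithmic factors.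
   Formalization: The regret bound is shown with probability at least 1−δ when the two assumed bounds hold simultaneously with probability at least 1−δ, and with probability at least 1−2δ when each holds separately; the claim as worded fails if they hold on unrelated events. *)

theory Defs
  imports "HOL-Probability.Probability"
begin

section \<open>Finite-horizon MDPs\<close>

text \<open>
  States and actions form arbitrary measurable spaces. Stages are \<open>1, \<dots>, horizon\<close>; the data of an
  MDP or of a policy at other stages is irrelevant. \<open>reward M h (s, a)\<close> is the law of the random
  reward.
\<close>

record ('s, 'a) mdp =
  states :: "'s measure"
  actions :: "'a measure"
  horizon :: nat
  initial :: 's
  kernel :: "nat \<Rightarrow> 's \<times> 'a \<Rightarrow> 's measure"
  reward :: "nat \<Rightarrow> 's \<times> 'a \<Rightarrow> real measure"

type_synonym ('s, 'a) policy = "nat \<Rightarrow> 's \<Rightarrow> 'a measure"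

text \<open>The value of a trajectory at stage \<open>h\<close> is the triple (state, action, realised reward).\<close>

type_synonym ('s, 'a) trajectory = "nat \<Rightarrow> 's \<times> 'a \<times> real"

definition policies :: "('s, 'a) mdp \<Rightarrow> ('s, 'a) policy set" where
  "policies M = {\<pi>. \<forall>h\<in>{1..horizon M}. \<pi> h \<in> states M \<rightarrow>\<^sub>M prob_algebra (actions M)}"

definition mean_reward :: "('s, 'a) mdp \<Rightarrow> nat \<Rightarrow> 's \<Rightarrow> 'a \<Rightarrow> real" where
  "mean_reward M h s a = (\<integral>x. x \<partial>reward M h (s, a))"

definition step_space :: "('s, 'a) mdp \<Rightarrow> ('s \<times> 'a \<times> real) measure" where
  "step_space M = states M \<Otimes>\<^sub>M (actions M \<Otimes>\<^sub>M borel)"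

text \<open>
  \<open>episode_from M \<pi> n h s\<close> is the law of the stages \<open>h, \<dots>, h + n - 1\<close> of an episode in which stage
  \<open>h\<close> starts in state \<open>s\<close> and \<open>\<pi>\<close> is followed.
\<close>

primrec episode_from ::
  "('s, 'a) mdp \<Rightarrow> ('s, 'a) policy \<Rightarrow> nat \<Rightarrow> nat \<Rightarrow> 's \<Rightarrow> ('s, 'a) trajectory measure" where
  "episode_from M \<pi> 0 h s = return (PiM {} (\<lambda>_. step_space M)) (\<lambda>_. undefined)"
| "episode_from M \<pi> (Suc n) h s =
    do {
      a \<leftarrow> \<pi> h s;
      r \<leftarrow> reward M h (s, a);
      s' \<leftarrow> kernel M h (s, a);
      \<omega> \<leftarrow> episode_from M \<pi> n (Suc h) s';
      return (PiM {h..<h + Suc n} (\<lambda>_. step_space M)) (fun_upd \<omega> h (s, a, r))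
    }"

definition traj_space :: "('s, 'a) mdp \<Rightarrow> ('s, 'a) trajectory measure" where
  "traj_space M = PiM {1..horizon M} (\<lambda>_. step_space M)"

definition traj_law :: "('s, 'a) mdp \<Rightarrow> ('s, 'a) policy \<Rightarrow> ('s, 'a) trajectory measure" where
  "traj_law M \<pi> = episode_from M \<pi> (horizon M) 1 (initial M)"

abbreviation stage_mean :: "('s, 'a) mdp \<Rightarrow> nat \<Rightarrow> ('s, 'a) trajectory \<Rightarrow> real" where
  "stage_mean M h \<omega> \<equiv> mean_reward M h (fst (\<omega> h)) (fst (snd (\<omega> h)))"

definition policy_value :: "('s, 'a) mdp \<Rightarrow> ('s, 'a) policy \<Rightarrow> real" where
  "policy_value M \<pi> = (\<integral>\<omega>. (\<Sum>h = 1..horizon M. stage_mean M h \<omega>) \<partial>traj_law M \<pi>)"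

definition opt_value :: "('s, 'a) mdp \<Rightarrow> real" where
  "opt_value M = (SUP \<pi>\<in>policies M. policy_value M \<pi>)"

text \<open>
  The last two clauses say that all values, and the optimal value, are well defined. The supremum
  need not be attained; when it is, \<open>opt_value M\<close> is the maximum.
\<close>

definition is_mdp :: "('s, 'a) mdp \<Rightarrow> bool" where
  "is_mdp M \<longleftrightarrow>
    1 \<le> horizon M \<and>
    initial M \<in> space (states M) \<and>
    (\<forall>h\<in>{1..horizon M}.
      kernel M h \<in> states M \<Otimes>\<^sub>M actions M \<rightarrow>\<^sub>M prob_algebra (states M) \<and>
      reward M h \<in> states M \<Otimes>\<^sub>M actions M \<rightarrow>\<^sub>M prob_algebra borel \<and>
      (\<forall>z\<in>space (states M \<Otimes>\<^sub>M actions M). integrable (reward M h z) (\<lambda>x. x))) \<and>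
    (\<forall>\<pi>\<in>policies M. \<forall>h\<in>{1..horizon M}. integrable (traj_law M \<pi>) (stage_mean M h)) \<and>
    bdd_above (policy_value M ` policies M)"


section \<open>Algorithms and their runs\<close>

text \<open>
  \<open>select \<AA> u xs\<close> is the policy chosen for the next episode when the past trajectories are \<open>xs\<close>,
  oldest first. Randomised algorithms draw \<open>u\<close> from the law \<open>seed \<AA>\<close> once, before the first
  episode; this can encode fresh randomness for every episode, and a deterministic algorithm
  ignores \<open>u\<close>.
\<close>

record ('u, 's, 'a) algorithm =
  seed :: "'u measure"
  select :: "'u \<Rightarrow> ('s, 'a) trajectory list \<Rightarrow> ('s, 'a) policy"

definition first_obs :: "nat \<Rightarrow> (nat \<Rightarrow> 'b) \<Rightarrow> 'b list" where
  "first_obs n x = map x [1..<Suc n]"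

definition hist_space ::
  "('s, 'a) mdp \<Rightarrow> ('u, 's, 'a) algorithm \<Rightarrow> nat \<Rightarrow> ('u \<times> (nat \<Rightarrow> ('s, 'a) trajectory)) measure" where
  "hist_space M \<AA> n = seed \<AA> \<Otimes>\<^sub>M PiM {1..n} (\<lambda>_. traj_space M)"

text \<open>
  The measurability condition makes the selected policy a Markov kernel jointly in the history and
  the state. In particular every selected policy belongs to \<open>policies M\<close>.
\<close>

definition is_algorithm :: "('s, 'a) mdp \<Rightarrow> ('u, 's, 'a) algorithm \<Rightarrow> bool" where
  "is_algorithm M \<AA> \<longleftrightarrow>
    prob_space (seed \<AA>) \<and>
    (\<forall>n. \<forall>h\<in>{1..horizon M}.
      (\<lambda>((u, x), s). select \<AA> u (first_obs n x) h s)
        \<in> hist_space M \<AA> n \<Otimes>\<^sub>M states M \<rightarrow>\<^sub>M prob_algebra (actions M))"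

text \<open>
  \<open>lcb u xs k\<close> is the bound on the value of the \<open>k\<close>-th selected policy, computed at time
  \<open>t = length xs + 1\<close> from the trajectories \<open>xs\<close> of the first \<open>t - 1\<close> episodes.
\<close>

type_synonym ('u, 's, 'a) lower_bounds = "'u \<Rightarrow> ('s, 'a) trajectory list \<Rightarrow> nat \<Rightarrow> real"

definition computable_bounds ::
  "('s, 'a) mdp \<Rightarrow> ('u, 's, 'a) algorithm \<Rightarrow> ('u, 's, 'a) lower_bounds \<Rightarrow> bool" where
  "computable_bounds M \<AA> lcb \<longleftrightarrow>
    (\<forall>n. \<forall>k\<in>{1..Suc n}.
      (\<lambda>(u, x). lcb u (first_obs n x) k) \<in> borel_measurable (hist_space M \<AA> n))"

text \<open>
  A run of \<open>\<AA>\<close> in the environment \<open>M\<close>: on the probability space \<open>\<Omega>\<close>, the seed \<open>U\<close> has the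
  prescribed law, and the conditional law of the trajectory \<open>X (n + 1)\<close> of episode \<open>n + 1\<close>, given
  the seed and the first \<open>n\<close> trajectories, is the trajectory law of the policy selected from them.
  This determines the joint law of \<open>U\<close> and \<open>X\<close>.
\<close>

definition is_run ::
  "('s, 'a) mdp \<Rightarrow> ('u, 's, 'a) algorithm \<Rightarrow> 'w measure \<Rightarrow> ('w \<Rightarrow> 'u) \<Rightarrow>
    (nat \<Rightarrow> 'w \<Rightarrow> ('s, 'a) trajectory) \<Rightarrow> bool" where
  "is_run M \<AA> \<Omega> U X \<longleftrightarrow>
    prob_space \<Omega> \<and>
    U \<in> \<Omega> \<rightarrow>\<^sub>M seed \<AA> \<and> distr \<Omega> (seed \<AA>) U = seed \<AA> \<and>
    (\<forall>t\<ge>1. X t \<in> \<Omega> \<rightarrow>\<^sub>M traj_space M) \<and>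
    (\<forall>n. let hist = (\<lambda>\<omega>. (U \<omega>, \<lambda>i\<in>{1..n}. X i \<omega>));
             joint = hist_space M \<AA> n \<Otimes>\<^sub>M traj_space M
         in distr \<Omega> joint (\<lambda>\<omega>. (hist \<omega>, X (Suc n) \<omega>)) =
            do {
              (u, x) \<leftarrow> distr \<Omega> (hist_space M \<AA> n) hist;
              y \<leftarrow> traj_law M (select \<AA> u (first_obs n x));
              return joint ((u, x), y)
            })"

text \<open>The trajectories observed before episode \<open>t\<close>, and the policy played in episode \<open>t\<close>.\<close>

definition observed :: "(nat \<Rightarrow> 'w \<Rightarrow> 'b) \<Rightarrow> nat \<Rightarrow> 'w \<Rightarrow> 'b list" where
  "observed X t \<omega> = first_obs (t - 1) (\<lambda>i. X i \<omega>)"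

definition played ::
  "('u, 's, 'a) algorithm \<Rightarrow> ('w \<Rightarrow> 'u) \<Rightarrow> (nat \<Rightarrow> 'w \<Rightarrow> ('s, 'a) trajectory) \<Rightarrow>
    nat \<Rightarrow> 'w \<Rightarrow> ('s, 'a) policy" where
  "played \<AA> U X t \<omega> = select \<AA> (U \<omega>) (observed X t \<omega>)"

definition regret ::
  "('s, 'a) mdp \<Rightarrow> ('u, 's, 'a) algorithm \<Rightarrow> ('w \<Rightarrow> 'u) \<Rightarrow>
    (nat \<Rightarrow> 'w \<Rightarrow> ('s, 'a) trajectory) \<Rightarrow> nat \<Rightarrow> 'w \<Rightarrow> real" where
  "regret M \<AA> U X T \<omega> = (\<Sum>t = 1..T. opt_value M - policy_value M (played \<AA> U X t \<omega>))"

definition lcb_error ::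
  "('s, 'a) mdp \<Rightarrow> ('u, 's, 'a) algorithm \<Rightarrow> ('u, 's, 'a) lower_bounds \<Rightarrow> ('w \<Rightarrow> 'u) \<Rightarrow>
    (nat \<Rightarrow> 'w \<Rightarrow> ('s, 'a) trajectory) \<Rightarrow> nat \<Rightarrow> 'w \<Rightarrow> real" where
  "lcb_error M \<AA> lcb U X t \<omega> =
    (\<Sum>k = 1..t. policy_value M (played \<AA> U X k \<omega>) - lcb (U \<omega>) (observed X t \<omega>) k)"


section \<open>The algorithm LCBCE\<close>

text \<open>
  The internal state is the pair \<open>(B, ys)\<close> of the accumulated budget and the trajectories fed to the
  base algorithm so far; \<open>t' = length ys\<close>. \<open>V0\<close> is the known value of the baseline policy.
\<close>

definition plays_baseline ::
  "('u, 's, 'a) lower_bounds \<Rightarrow> real \<Rightarrow> real \<Rightarrow> 'u \<Rightarrow> real \<times> ('s, 'a) trajectory list \<Rightarrow> bool" where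
  "plays_baseline lcb V0 \<alpha> u = (\<lambda>(B, ys).
    real (length ys + 1) * (1 - \<alpha>) * V0 - (\<Sum>k = 1..length ys + 1. lcb u ys k) > B)"

definition lcbce_state ::
  "('u, 's, 'a) lower_bounds \<Rightarrow> real \<Rightarrow> real \<Rightarrow> 'u \<Rightarrow> ('s, 'a) trajectory list \<Rightarrow>
    real \<times> ('s, 'a) trajectory list" where
  "lcbce_state lcb V0 \<alpha> u = foldl
    (\<lambda>(B, ys) x. if plays_baseline lcb V0 \<alpha> u (B, ys) then (B + \<alpha> * V0, ys) else (B, ys @ [x]))
    (0, [])"

definition lcbce ::
  "('u, 's, 'a) algorithm \<Rightarrow> ('u, 's, 'a) lower_bounds \<Rightarrow> ('s, 'a) policy \<Rightarrow> real \<Rightarrow> real \<Rightarrow>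
    ('u, 's, 'a) algorithm" where
  "lcbce \<AA> lcb \<pi>0 V0 \<alpha> =
    \<lparr>seed = seed \<AA>,
     select = (\<lambda>u xs.
       if plays_baseline lcb V0 \<alpha> u (lcbce_state lcb V0 \<alpha> u xs) then \<pi>0
       else select \<AA> u (snd (lcbce_state lcb V0 \<alpha> u xs)))\<rparr>"


section \<open>Bounds up to logarithmic factors\<close>

text \<open>
  The factor hidden by a soft-O bound in \<open>t\<close>: a constant \<open>c\<close> times a power of \<open>ln (\<kappa> t)\<close>. The number
  \<open>\<kappa> \<ge> exp 1\<close> may depend on the whole problem (confidence level, horizon, sizes of the state and
  action spaces, ...), whereas \<open>c\<close> and \<open>p\<close> are universal constants. The bound on \<open>\<kappa>\<close> ensures
  \<open>ln (\<kappa> t) \<ge> 1\<close> for \<open>t \<ge> 1\<close>.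
\<close>

definition hidden_factor :: "real \<Rightarrow> nat \<Rightarrow> real \<Rightarrow> nat \<Rightarrow> real" where
  "hidden_factor c p \<kappa> t = c * ln (\<kappa> * real t) ^ p"

end

theory Submission
  imports Defs
begin

text \<open>
  Inside LCBCE the base algorithm \<open>\<AA>\<close> is fed only in the episodes in which it is played, and whether
  it is played depends on the past alone. Let \<open>P\<close> be a property of histories of \<open>\<AA>\<close> that is inherited
  by prefixes (here: regret and confidence errors have stayed within their bounds). The conditional
  probability that \<open>P\<close> holds after \<open>T\<close> fed episodes is a martingale along LCBCE, it starts at the
  probability of \<open>P\<close> in a run of \<open>\<AA>\<close> on its own, and it is at most the indicator of \<open>P\<close> at the current
  fed history. So the bounds hold along the fed history with at least the probability they have for
  \<open>\<AA>\<close> alone.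

  On that event, let \<open>a = \<alpha> V0\<close>, let \<open>N\<close> be the number of baseline episodes and consider the last one,
  with \<open>n\<close> episodes fed before it. Its decision rule gives \<open>(N - 1) a < K \<surd>m - m (a + \<Delta>0)\<close> for
  \<open>m = n + 1\<close>, where \<open>K\<close> is \<open>C\<close> up to logarithms. Maximising over \<open>m\<close> bounds \<open>(N - 1) \<Delta>0\<close> by a multiple of
  \<open>K\<^sup>2 \<Delta>0 / (a (a + \<Delta>0))\<close>, and \<open>m \<ge> 1\<close> forces \<open>\<Delta>0 < K\<close>.
\<close>

section \<open>Measurability\<close>

text \<open>The parameter \<open>z\<close> will be a history. Measurability is carried jointly in
  \<open>z\<close> and the starting state because the recursive call starts in a random state. With
  \<open>h\<close> generalised in the induction, every stage is a bind of measurable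
  kernels.\<close>

lemma measurable_episode_from:
  assumes M: "is_mdp M"
    and pol: "\<And>h. h \<in> {1..horizon M} \<Longrightarrow>
      (\<lambda>(z, s). pol z h s) \<in> Z \<Otimes>\<^sub>M states M \<rightarrow>\<^sub>M prob_algebra (actions M)"
    and "1 \<le> h" "h + n \<le> Suc (horizon M)"
  shows "(\<lambda>(z, s). episode_from M (pol z) n h s)
    \<in> Z \<Otimes>\<^sub>M states M \<rightarrow>\<^sub>M prob_algebra (PiM {h..<h + n} (\<lambda>_. step_space M))"
  using assms(3,4)
proof (induction n arbitrary: h)
  case 0
  \<comment> \<open>With no stage left the product has an empty index set, and its only point is the
    everywhere undefined function.\<close>
  have "return (PiM {} (\<lambda>_. step_space M)) (\<lambda>_. undefined)
      \<in> space (prob_algebra (PiM {} (\<lambda>_. step_space M)))"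
    by (auto simp: space_prob_algebra space_PiM intro!: prob_space_return)
  then show ?case by simp
next
  case (Suc n)
  have h: "h \<in> {1..horizon M}" using Suc.prems by auto
  note pol[OF h, measurable]
  have [measurable]: "kernel M h \<in> states M \<Otimes>\<^sub>M actions M \<rightarrow>\<^sub>M prob_algebra (states M)"
    "reward M h \<in> states M \<Otimes>\<^sub>M actions M \<rightarrow>\<^sub>M prob_algebra borel"
    using M h by (auto simp: is_mdp_def)
  have IH[measurable]: "(\<lambda>(z, s). episode_from M (pol z) n (Suc h) s)
    \<in> Z \<Otimes>\<^sub>M states M \<rightarrow>\<^sub>M prob_algebra (PiM {Suc h..<Suc h + n} (\<lambda>_. step_space M))"
    using Suc.IH[of "Suc h"] Suc.prems by simp
  \<comment> \<open>Writing stage \<open>h\<close> into a trajectory of the later stages adjoins one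
    coordinate to a product.\<close>
  have "{h..<h + Suc n} = insert h {Suc h..<Suc h + n}" by auto
  then have [measurable]: "(\<lambda>(w, v). w(h := v)) \<in> PiM {Suc h..<Suc h + n} (\<lambda>_. step_space M) \<Otimes>\<^sub>M
      (states M \<Otimes>\<^sub>M (actions M \<Otimes>\<^sub>M borel)) \<rightarrow>\<^sub>M PiM {h..<h + Suc n} (\<lambda>_. step_space M)"
    using measurable_add_dim[where M="\<lambda>_. step_space M" and i=h and I="{Suc h..<Suc h + n}"]
    by (simp add: step_space_def[symmetric])
  show ?case
    unfolding episode_from.simps
    by measurable
qed


lemma measurable_traj_law:
  assumes M: "is_mdp M"
    and pol: "\<And>h. h \<in> {1..horizon M} \<Longrightarrow>
      (\<lambda>(z, s). pol z h s) \<in> Z \<Otimes>\<^sub>M states M \<rightarrow>\<^sub>M prob_algebra (actions M)"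
  shows "(\<lambda>z. traj_law M (pol z)) \<in> Z \<rightarrow>\<^sub>M prob_algebra (traj_space M)"
proof -
  have "{1..<1 + horizon M} = {1..horizon M}" by auto
  with measurable_episode_from[OF M pol, where h = 1 and n = "horizon M"]
  have [measurable]: "(\<lambda>(z, s). episode_from M (pol z) (horizon M) 1 s)
      \<in> Z \<Otimes>\<^sub>M states M \<rightarrow>\<^sub>M prob_algebra (traj_space M)"
    by (simp add: traj_space_def)
  have [measurable]: "initial M \<in> space (states M)"
    using M by (simp add: is_mdp_def)
  show ?thesis
    unfolding traj_law_def by measurable
qed

lemma borel_measurable_stage_mean:
  assumes M: "is_mdp M" and h: "h \<in> {1..horizon M}"
  shows "stage_mean M h \<in> borel_measurable (traj_space M)"
proof -
  have "reward M h \<in> states M \<Otimes>\<^sub>M actions M \<rightarrow>\<^sub>M subprob_algebra borel"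
    using M h by (auto simp: is_mdp_def intro: measurable_prob_algebraD)
  then have [measurable]: "(\<lambda>z. \<integral>x. x \<partial>reward M h z) \<in> borel_measurable (states M \<Otimes>\<^sub>M actions M)"
    by measurable
  have [measurable]: "(\<lambda>\<omega>. \<omega> h) \<in> traj_space M \<rightarrow>\<^sub>M states M \<Otimes>\<^sub>M (actions M \<Otimes>\<^sub>M borel)"
    unfolding traj_space_def step_space_def[symmetric] using h by measurable
  show ?thesis
    unfolding mean_reward_def by measurable
qed

lemma borel_measurable_policy_value:
  assumes M: "is_mdp M"
    and L: "(\<lambda>z. traj_law M (pol z)) \<in> Z \<rightarrow>\<^sub>M prob_algebra (traj_space M)"
  shows "(\<lambda>z. policy_value M (pol z)) \<in> borel_measurable Z"
proof -
  note borel_measurable_stage_mean[OF M, measurable] L[THEN measurable_prob_algebraD, measurable]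
  show ?thesis
    unfolding policy_value_def by measurable
qed

lemma policy_value_le_opt_value:
  assumes "is_mdp M" "\<pi> \<in> policies M"
  shows "policy_value M \<pi> \<le> opt_value M"
  unfolding opt_value_def using assms by (auto simp: is_mdp_def intro!: cSUP_upper)

section \<open>Histories as lists, and measurable functions of them\<close>

lemma first_obs_0 [simp]: "first_obs 0 x = []"
  by (simp add: first_obs_def)

lemma first_obs_Suc: "first_obs (Suc n) x = first_obs n x @ [x (Suc n)]"
  by (simp add: first_obs_def)

lemma length_first_obs [simp]: "length (first_obs n x) = n"
  by (simp add: first_obs_def)

lemma nth_first_obs: "i < n \<Longrightarrow> first_obs n x ! i = x (Suc i)"
  by (simp add: first_obs_def del: upt_Suc)

lemma first_obs_cong: "(\<And>i. 1 \<le> i \<Longrightarrow> i \<le> n \<Longrightarrow> x i = y i) \<Longrightarrow> first_obs n x = first_obs n y"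
  by (rule nth_equalityI) (simp_all add: nth_first_obs)

lemma take_first_obs: "take k (first_obs n x) = first_obs (min k n) x"
  by (rule nth_equalityI) (simp_all add: nth_first_obs)

lemma first_obs_nth: "first_obs (length ys) (\<lambda>i. ys ! (i - 1)) = ys"
  by (rule nth_equalityI) (simp_all add: nth_first_obs)

text \<open>Lists carry no sigma-algebra here; measurability is tested separately for each length
  \<open>n\<close>, on the product space that encodes histories of that length.\<close>

definition hist_measurable ::
  "('s, 'a) mdp \<Rightarrow> ('u, 's, 'a) algorithm \<Rightarrow> ('u \<Rightarrow> ('s, 'a) trajectory list \<Rightarrow> 'b) \<Rightarrow> 'b measure \<Rightarrow> bool"
  where "hist_measurable M \<AA> f N \<longleftrightarrow> (\<forall>n. (\<lambda>(u, x). f u (first_obs n x)) \<in> hist_space M \<AA> n \<rightarrow>\<^sub>M N)"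

lemma hist_measurableD:
  "hist_measurable M \<AA> f N \<Longrightarrow> (\<lambda>z. f (fst z) (first_obs n (snd z))) \<in> hist_space M \<AA> n \<rightarrow>\<^sub>M N"
  by (simp add: hist_measurable_def case_prod_beta')

lemma hist_measurableI:
  "(\<And>n. (\<lambda>z. f (fst z) (first_obs n (snd z))) \<in> hist_space M \<AA> n \<rightarrow>\<^sub>M N) \<Longrightarrow> hist_measurable M \<AA> f N"
  by (simp add: hist_measurable_def case_prod_beta')

lemma measurable_hist_space:
  assumes "f \<in> Z \<rightarrow>\<^sub>M seed \<AA>" "\<And>i. i \<in> {1..n} \<Longrightarrow> g i \<in> Z \<rightarrow>\<^sub>M traj_space M"
  shows "(\<lambda>z. (f z, \<lambda>i\<in>{1..n}. g i z)) \<in> Z \<rightarrow>\<^sub>M hist_space M \<AA> n"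
  unfolding hist_space_def using assms by (intro measurable_Pair measurable_restrict) auto

text \<open>\<open>first_obs n\<close> reads only the coordinates 1 to \<open>n\<close>, so any
  measurable choice of these coordinates may be substituted; truncation, extension and deletion of
  episodes are all instances.\<close>

lemma hist_measurable_compose:
  assumes "hist_measurable M \<AA> F N"
    "f \<in> Z \<rightarrow>\<^sub>M seed \<AA>" "\<And>i. 1 \<le> i \<Longrightarrow> i \<le> n \<Longrightarrow> g i \<in> Z \<rightarrow>\<^sub>M traj_space M"
  shows "(\<lambda>z. F (f z) (first_obs n (\<lambda>i. g i z))) \<in> Z \<rightarrow>\<^sub>M N"
proof -
  have "first_obs n (\<lambda>i\<in>{1..n}. g i z) = first_obs n (\<lambda>i. g i z)" for z
    by (rule first_obs_cong) auto
  moreover have "(\<lambda>z. (f z, \<lambda>i\<in>{1..n}. g i z)) \<in> Z \<rightarrow>\<^sub>M hist_space M \<AA> n"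
    by (rule measurable_hist_space) (use assms in auto)
  from measurable_compose[OF this hist_measurableD[OF assms(1)]]
  have "(\<lambda>z. F (f z) (first_obs n (\<lambda>i\<in>{1..n}. g i z))) \<in> Z \<rightarrow>\<^sub>M N"
    by simp
  ultimately show ?thesis by simp
qed

lemma measurable_hist_space_fst [measurable]: "fst \<in> hist_space M \<AA> n \<rightarrow>\<^sub>M seed \<AA>"
  by (simp add: hist_space_def)

lemma measurable_hist_space_component:
  "1 \<le> i \<Longrightarrow> i \<le> n \<Longrightarrow> (\<lambda>z. snd z i) \<in> hist_space M \<AA> n \<rightarrow>\<^sub>M traj_space M"
  unfolding hist_space_def
  by (rule measurable_compose[OF measurable_snd measurable_component_singleton]) auto

lemma hist_measurable_space:
  assumes "hist_measurable M \<AA> F N" "u \<in> space (seed \<AA>)" "set ys \<subseteq> space (traj_space M)"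
  shows "F u ys \<in> space N"
proof -
  \<comment> \<open>A single list is a history chosen by a constant map on a one-point space, so
    measurability yields the pointwise membership.\<close>
  have "(\<lambda>_::unit. F u (first_obs (length ys) (\<lambda>i. ys ! (i - 1)))) \<in> count_space UNIV \<rightarrow>\<^sub>M N"
    by (rule hist_measurable_compose[OF assms(1)]) (use assms(2,3) in \<open>auto simp: subset_iff\<close>)
  then have "F u (first_obs (length ys) (\<lambda>i. ys ! (i - 1))) \<in> space N"
    by (auto dest: measurable_space)
  then show ?thesis by (simp only: first_obs_nth)
qed

lemma hist_measurable_take:
  assumes "hist_measurable M \<AA> F N"
  shows "hist_measurable M \<AA> (\<lambda>u ys. F u (take k ys)) N"
  by (rule hist_measurableI, unfold take_first_obs, rule hist_measurable_compose[OF assms])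
    (auto intro: measurable_hist_space_component)

lemma hist_measurable_snoc:
  assumes "hist_measurable M \<AA> F N"
  shows "(\<lambda>(z, y). F (fst z) (first_obs n (snd z) @ [y])) \<in> hist_space M \<AA> n \<Otimes>\<^sub>M traj_space M \<rightarrow>\<^sub>M N"
proof -
  have "F u (first_obs n x @ [y]) = F u (first_obs (Suc n) (\<lambda>i. if i = Suc n then y else x i))" for u x y
    unfolding first_obs_Suc by (auto intro!: arg_cong[where f = "F u"] first_obs_cong)
  moreover have "(\<lambda>zy. F (fst (fst zy)) (first_obs (Suc n) (\<lambda>i. if i = Suc n then snd zy else snd (fst zy) i)))
      \<in> hist_space M \<AA> n \<Otimes>\<^sub>M traj_space M \<rightarrow>\<^sub>M N"
  proof (rule hist_measurable_compose[OF assms])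
    fix i assume "1 \<le> i" "i \<le> Suc n"
    then show "(\<lambda>zy. if i = Suc n then snd zy else snd (fst zy) i) \<in> hist_space M \<AA> n \<Otimes>\<^sub>M traj_space M \<rightarrow>\<^sub>M traj_space M"
      by (cases "i = Suc n") (auto intro!: measurable_compose[OF measurable_fst measurable_hist_space_component])
  qed measurable
  ultimately show ?thesis by (simp add: case_prod_beta')
qed

lemma hist_measurable_traj_law:
  assumes "is_mdp M" "is_algorithm M \<AA>"
  shows "hist_measurable M \<AA> (\<lambda>u ys. traj_law M (select \<AA> u ys)) (prob_algebra (traj_space M))"
proof (rule hist_measurableI, rule measurable_traj_law[OF assms(1)])
  fix n h assume "h \<in> {1..horizon M}"
  with assms(2) have "(\<lambda>((u, x), s). select \<AA> u (first_obs n x) h s)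
      \<in> hist_space M \<AA> n \<Otimes>\<^sub>M states M \<rightarrow>\<^sub>M prob_algebra (actions M)"
    by (simp add: is_algorithm_def)
  then show "(\<lambda>(z, s). select \<AA> (fst z) (first_obs n (snd z)) h s)
      \<in> hist_space M \<AA> n \<Otimes>\<^sub>M states M \<rightarrow>\<^sub>M prob_algebra (actions M)"
    by (simp only: case_prod_beta')
qed

lemma select_in_policies:
  assumes "is_algorithm M \<AA>" "u \<in> space (seed \<AA>)" "set ys \<subseteq> space (traj_space M)"
  shows "select \<AA> u ys \<in> policies M"
  unfolding policies_def
proof safe
  fix h assume h: "h \<in> {1..horizon M}"
  define n where "n = length ys"
  \<comment> \<open>The restriction to \<open>{1..n}\<close> makes \<open>x\<close> a genuine point
    of the product space; freezing it in the joint kernel leaves a kernel in the state.\<close>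
  define x where "x = (\<lambda>i\<in>{1..n}. ys ! (i - 1))"
  have "first_obs n x = first_obs n (\<lambda>i. ys ! (i - 1))"
    by (rule first_obs_cong) (simp add: x_def)
  then have x: "first_obs n x = ys"
    by (simp only: n_def first_obs_nth)
  have "ys ! (i - 1) \<in> space (traj_space M)" if "i \<in> {1..n}" for i
    using assms(3) that nth_mem[of "i - 1" ys] by (auto simp: n_def)
  then have z: "(u, x) \<in> space (hist_space M \<AA> n)"
    using assms(2) by (simp add: hist_space_def space_pair_measure space_PiM x_def)
  have "(\<lambda>((u, x), s). select \<AA> u (first_obs n x) h s)
      \<in> hist_space M \<AA> n \<Otimes>\<^sub>M states M \<rightarrow>\<^sub>M prob_algebra (actions M)"
    using assms(1) h by (simp add: is_algorithm_def)
  from measurable_compose[OF measurable_Pair1'[OF z] this]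
  have "(\<lambda>s. select \<AA> u (first_obs n x) h s) \<in> states M \<rightarrow>\<^sub>M prob_algebra (actions M)"
    by (simp only: prod.case)
  then show "select \<AA> u ys h \<in> states M \<rightarrow>\<^sub>M prob_algebra (actions M)"
    by (simp only: x)
qed

section \<open>Expectations along a run\<close>

text \<open>The tower property for one episode: the joint law prescribed by \<open>is_run\<close> is
  integrated through its two binds and the final \<open>return\<close>.\<close>

lemma nn_integral_run_step:
  fixes f :: "'u \<Rightarrow> ('s, 'a) trajectory list \<Rightarrow> ennreal"
  assumes run: "is_run M \<AA> \<Omega> U X"
    and K: "hist_measurable M \<AA> (\<lambda>u ys. traj_law M (select \<AA> u ys)) (prob_algebra (traj_space M))"
    and f: "hist_measurable M \<AA> f borel"
  shows "(\<integral>\<^sup>+\<omega>. f (U \<omega>) (first_obs (Suc n) (\<lambda>i. X i \<omega>)) \<partial>\<Omega>) =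
    (\<integral>\<^sup>+\<omega>. (\<integral>\<^sup>+y. f (U \<omega>) (first_obs n (\<lambda>i. X i \<omega>) @ [y])
      \<partial>traj_law M (select \<AA> (U \<omega>) (first_obs n (\<lambda>i. X i \<omega>)))) \<partial>\<Omega>)"
proof -
  define H where "H = hist_space M \<AA> n"
  define J where "J = H \<Otimes>\<^sub>M traj_space M"
  define hist where "hist = (\<lambda>\<omega>. (U \<omega>, \<lambda>i\<in>{1..n}. X i \<omega>))"
  define L where "L = (\<lambda>z. traj_law M (select \<AA> (fst z) (first_obs n (snd z))))"
  define g where "g = (\<lambda>(z, y). f (fst z) (first_obs n (snd z) @ [y]))"
  have X: "X t \<in> \<Omega> \<rightarrow>\<^sub>M traj_space M" if "1 \<le> t" for t
    using run that by (simp add: is_run_def)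
  have U[measurable]: "U \<in> \<Omega> \<rightarrow>\<^sub>M seed \<AA>"
    using run by (simp add: is_run_def)
  have X'[measurable]: "X (Suc n) \<in> \<Omega> \<rightarrow>\<^sub>M traj_space M"
    by (rule X) simp
  have hist[measurable]: "hist \<in> \<Omega> \<rightarrow>\<^sub>M H"
    unfolding hist_def H_def by (intro measurable_hist_space U X) auto
  have "L \<in> H \<rightarrow>\<^sub>M prob_algebra (traj_space M)"
    unfolding L_def H_def by (rule hist_measurableD[OF K])
  then have L[measurable]: "L \<in> H \<rightarrow>\<^sub>M subprob_algebra (traj_space M)"
    by (rule measurable_prob_algebraD)
  have g[measurable]: "g \<in> borel_measurable J"
    unfolding g_def J_def H_def by (rule hist_measurable_snoc[OF f])
  have joint: "distr \<Omega> J (\<lambda>\<omega>. (hist \<omega>, X (Suc n) \<omega>)) =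
      distr \<Omega> H hist \<bind> (\<lambda>z. L z \<bind> (\<lambda>y. return J (z, y)))"
    using run by (auto simp: is_run_def Let_def hist_def H_def J_def L_def case_prod_beta')
  have obs: "first_obs n (\<lambda>i\<in>{1..n}. X i \<omega>) = first_obs n (\<lambda>i. X i \<omega>)" for \<omega>
    by (rule first_obs_cong) simp
  have ret[measurable]: "(\<lambda>(z, y). return J (z, y)) \<in> H \<Otimes>\<^sub>M traj_space M \<rightarrow>\<^sub>M subprob_algebra J"
    unfolding J_def by measurable
  have inner: "(\<integral>\<^sup>+w. g w \<partial>(L z \<bind> (\<lambda>y. return J (z, y)))) = (\<integral>\<^sup>+y. g (z, y) \<partial>L z)"
    if z: "z \<in> space H" for z
  proof -
    have sets: "sets (L z) = sets (traj_space M)"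
      using measurable_space[OF L z] by (simp add: space_subprob_algebra)
    have "(\<lambda>y. return J (z, y)) \<in> traj_space M \<rightarrow>\<^sub>M subprob_algebra J"
      using measurable_compose[OF measurable_Pair1'[OF z] ret] by simp
    then have "(\<lambda>y. return J (z, y)) \<in> L z \<rightarrow>\<^sub>M subprob_algebra J"
      by (simp add: measurable_cong_sets[OF sets])
    then have "(\<integral>\<^sup>+w. g w \<partial>(L z \<bind> (\<lambda>y. return J (z, y)))) =
        (\<integral>\<^sup>+y. (\<integral>\<^sup>+w. g w \<partial>return J (z, y)) \<partial>L z)"
      by (rule nn_integral_bind[OF g])
    also have "\<dots> = (\<integral>\<^sup>+y. g (z, y) \<partial>L z)"
      using z sets_eq_imp_space_eq[OF sets]
      by (intro nn_integral_cong nn_integral_return g) (simp add: J_def space_pair_measure)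
    finally show ?thesis .
  qed
  have outer: "(\<lambda>z. \<integral>\<^sup>+y. g (z, y) \<partial>L z) \<in> borel_measurable H"
    by (rule nn_integral_measurable_subprob_algebra2[OF _ L]) (use g in \<open>simp add: J_def\<close>)
  have "(\<integral>\<^sup>+\<omega>. f (U \<omega>) (first_obs (Suc n) (\<lambda>i. X i \<omega>)) \<partial>\<Omega>) =
      (\<integral>\<^sup>+\<omega>. g (hist \<omega>, X (Suc n) \<omega>) \<partial>\<Omega>)"
    by (simp only: g_def hist_def prod.case fst_conv snd_conv obs first_obs_Suc)
  also have "\<dots> = (\<integral>\<^sup>+w. g w \<partial>distr \<Omega> J (\<lambda>\<omega>. (hist \<omega>, X (Suc n) \<omega>)))"
    by (rule nn_integral_distr[symmetric]) (simp_all add: J_def[symmetric], simp add: J_def)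
  also have "\<dots> = (\<integral>\<^sup>+z. (\<integral>\<^sup>+w. g w \<partial>(L z \<bind> (\<lambda>y. return J (z, y)))) \<partial>distr \<Omega> H hist)"
    unfolding joint
    by (rule nn_integral_bind[OF g], subst measurable_distr_eq1, rule measurable_bind[OF L])
      (use ret in \<open>simp add: case_prod_beta'\<close>)
  also have "\<dots> = (\<integral>\<^sup>+z. (\<integral>\<^sup>+y. g (z, y) \<partial>L z) \<partial>distr \<Omega> H hist)"
    by (rule nn_integral_cong) (simp add: inner)
  also have "\<dots> = (\<integral>\<^sup>+\<omega>. (\<integral>\<^sup>+y. g (hist \<omega>, y) \<partial>L (hist \<omega>)) \<partial>\<Omega>)"
    by (rule nn_integral_distr[OF hist]) (simp add: outer)
  also have "\<dots> = (\<integral>\<^sup>+\<omega>. (\<integral>\<^sup>+y. f (U \<omega>) (first_obs n (\<lambda>i. X i \<omega>) @ [y])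
      \<partial>traj_law M (select \<AA> (U \<omega>) (first_obs n (\<lambda>i. X i \<omega>)))) \<partial>\<Omega>)"
    by (simp only: g_def hist_def L_def prod.case fst_conv snd_conv obs)
  finally show ?thesis .
qed

section \<open>Conditional expectations of functionals of the future history\<close>

text \<open>The conditional expectation of \<open>f\<close> after \<open>k\<close> further episodes
  of \<open>\<AA>\<close>, given the history \<open>ys\<close>. Iterated integration defines it at
  every history rather than almost everywhere along one run, so it can also be evaluated at the
  histories fed to \<open>\<AA>\<close> inside LCBCE.\<close>

primrec expect_after ::
  "('s, 'a) mdp \<Rightarrow> ('u, 's, 'a) algorithm \<Rightarrow> ('u \<Rightarrow> ('s, 'a) trajectory list \<Rightarrow> ennreal) \<Rightarrow>
    nat \<Rightarrow> 'u \<Rightarrow> ('s, 'a) trajectory list \<Rightarrow> ennreal" where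
  "expect_after M \<AA> f 0 u ys = f u ys"
| "expect_after M \<AA> f (Suc k) u ys =
    (\<integral>\<^sup>+y. expect_after M \<AA> f k u (ys @ [y]) \<partial>traj_law M (select \<AA> u ys))"

lemma hist_measurable_expect_after:
  assumes K: "hist_measurable M \<AA> (\<lambda>u ys. traj_law M (select \<AA> u ys)) (prob_algebra (traj_space M))"
    and f: "hist_measurable M \<AA> f borel"
  shows "hist_measurable M \<AA> (expect_after M \<AA> f k) borel"
proof (induction k)
  case 0
  then show ?case using f by (simp add: hist_measurable_def)
next
  case (Suc k)
  show ?case
    unfolding expect_after.simps
    by (intro hist_measurableI nn_integral_measurable_subprob_algebra2[where N = "traj_space M"]
        hist_measurable_snoc[OF Suc, simplified case_prod_beta'] measurable_prob_algebraD
        hist_measurableD[OF K, simplified] hist_measurable_snoc[OF Suc])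
qed

text \<open>Each application of the tower property moves one episode from the future
  \<open>k\<close> to the past \<open>n\<close>, hence the generalisation over
  \<open>n\<close>.\<close>

lemma nn_integral_expect_after:
  assumes run: "is_run M \<AA> \<Omega> U X"
    and K: "hist_measurable M \<AA> (\<lambda>u ys. traj_law M (select \<AA> u ys)) (prob_algebra (traj_space M))"
    and f: "hist_measurable M \<AA> f borel"
  shows "(\<integral>\<^sup>+\<omega>. expect_after M \<AA> f k (U \<omega>) (first_obs n (\<lambda>i. X i \<omega>)) \<partial>\<Omega>) =
    (\<integral>\<^sup>+\<omega>. f (U \<omega>) (first_obs (n + k) (\<lambda>i. X i \<omega>)) \<partial>\<Omega>)"
proof (induction k arbitrary: n)
  case (Suc k)
  from nn_integral_run_step[OF run K hist_measurable_expect_after[OF K f], of k n] Suc[of "Suc n"]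
  show ?case by simp
qed simp

text \<open>At the empty history only the seed is left, and \<open>is_run\<close> fixes its law.
  This is the link between runs on different probability spaces.\<close>

lemma nn_integral_seed:
  fixes f :: "'u \<Rightarrow> ('s, 'a) trajectory list \<Rightarrow> ennreal"
  assumes run: "is_run M \<AA> \<Omega> U X" and f: "hist_measurable M \<AA> f borel"
  shows "(\<integral>\<^sup>+\<omega>. f (U \<omega>) [] \<partial>\<Omega>) = (\<integral>\<^sup>+u. f u [] \<partial>seed \<AA>)"
proof -
  have U: "U \<in> \<Omega> \<rightarrow>\<^sub>M seed \<AA>" "distr \<Omega> (seed \<AA>) U = seed \<AA>"
    using run by (simp_all add: is_run_def)
  have "(\<lambda>u. f u (first_obs 0 (\<lambda>i. undefined))) \<in> borel_measurable (seed \<AA>)"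
    by (rule hist_measurable_compose[OF f]) auto
  with nn_integral_distr[OF U(1), of "\<lambda>u. f u []"] U(2) show ?thesis by simp
qed

text \<open>Once \<open>P\<close> fails it fails for every extension, so the expectation vanishes;
  otherwise it is at most 1 because the trajectory laws are probabilities.\<close>

lemma expect_after_le_indicator:
  assumes K: "hist_measurable M \<AA> (\<lambda>u ys. traj_law M (select \<AA> u ys)) (prob_algebra (traj_space M))"
    and closed: "\<And>ys y. P u (ys @ [y]) \<Longrightarrow> P u ys"
    and u: "u \<in> space (seed \<AA>)" and ys: "set ys \<subseteq> space (traj_space M)"
  shows "expect_after M \<AA> (\<lambda>u ys. of_bool (P u ys)) k u ys \<le> of_bool (P u ys)"
  using ys
proof (induction k arbitrary: ys)
  case (Suc k)
  let ?L = "traj_law M (select \<AA> u ys)"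
  have "?L \<in> space (prob_algebra (traj_space M))"
    by (rule hist_measurable_space[OF K u Suc.prems])
  then have L: "prob_space ?L" "space ?L = space (traj_space M)"
    by (auto simp: space_prob_algebra dest: sets_eq_imp_space_eq)
  have "expect_after M \<AA> (\<lambda>u ys. of_bool (P u ys)) (Suc k) u ys \<le> (\<integral>\<^sup>+y. of_bool (P u ys) \<partial>?L)"
    unfolding expect_after.simps
  proof (rule nn_integral_mono)
    fix y assume "y \<in> space ?L"
    then have "expect_after M \<AA> (\<lambda>u ys. of_bool (P u ys)) k u (ys @ [y]) \<le> of_bool (P u (ys @ [y]))"
      using Suc L by (intro Suc.IH) auto
    also have "\<dots> \<le> (of_bool (P u ys) :: ennreal)"
      using closed[of ys y] by (auto simp: of_bool_def)
    finally show "expect_after M \<AA> (\<lambda>u ys. of_bool (P u ys)) k u (ys @ [y]) \<le> of_bool (P u ys)" .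
  qed
  also have "\<dots> = of_bool (P u ys)"
    by (simp add: prob_space.emeasure_space_1[OF L(1)])
  finally show ?case .
qed simp

section \<open>The base algorithm inside LCBCE\<close>

abbreviation fed ::
  "('u, 's, 'a) lower_bounds \<Rightarrow> real \<Rightarrow> real \<Rightarrow> 'u \<Rightarrow> ('s, 'a) trajectory list \<Rightarrow> ('s, 'a) trajectory list"
  where "fed lcb V0 \<alpha> u xs \<equiv> snd (lcbce_state lcb V0 \<alpha> u xs)"

text \<open>
  The budget is determined by the number of episodes played and the number of episodes fed, so the
  decision is a function of the former and the fed history.
\<close>

definition idle ::
  "('u, 's, 'a) lower_bounds \<Rightarrow> real \<Rightarrow> real \<Rightarrow> nat \<Rightarrow> 'u \<Rightarrow> ('s, 'a) trajectory list \<Rightarrow> bool"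
  where "idle lcb V0 \<alpha> n u ys \<longleftrightarrow> plays_baseline lcb V0 \<alpha> u (real (n - length ys) * (\<alpha> * V0), ys)"

section \<open>Recursion for the budget and the fed history\<close>

lemma lcbce_state_Nil [simp]: "lcbce_state lcb V0 \<alpha> u [] = (0, [])"
  by (simp add: lcbce_state_def)

lemma lcbce_state_snoc:
  "lcbce_state lcb V0 \<alpha> u (xs @ [x]) =
    (if plays_baseline lcb V0 \<alpha> u (lcbce_state lcb V0 \<alpha> u xs)
     then (fst (lcbce_state lcb V0 \<alpha> u xs) + \<alpha> * V0, fed lcb V0 \<alpha> u xs)
     else (fst (lcbce_state lcb V0 \<alpha> u xs), fed lcb V0 \<alpha> u xs @ [x]))"
  by (simp add: lcbce_state_def case_prod_beta')

lemma length_fed_le: "length (fed lcb V0 \<alpha> u xs) \<le> length xs"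
  by (induction xs rule: rev_induct) (auto simp: lcbce_state_snoc)

lemma set_fed_subset: "set (fed lcb V0 \<alpha> u xs) \<subseteq> set xs"
  by (induction xs rule: rev_induct) (auto simp: lcbce_state_snoc)

lemma budget_eq:
  "fst (lcbce_state lcb V0 \<alpha> u xs) = real (length xs - length (fed lcb V0 \<alpha> u xs)) * (\<alpha> * V0)"
proof (induction xs rule: rev_induct)
  case (snoc x xs)
  with length_fed_le[of lcb V0 \<alpha> u xs] show ?case
    by (auto simp: lcbce_state_snoc Suc_diff_le algebra_simps)
qed simp

lemma plays_baseline_iff_idle:
  "plays_baseline lcb V0 \<alpha> u (lcbce_state lcb V0 \<alpha> u xs) \<longleftrightarrow>
    idle lcb V0 \<alpha> (length xs) u (fed lcb V0 \<alpha> u xs)"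
  by (simp add: idle_def budget_eq[symmetric])

lemma fed_snoc:
  "fed lcb V0 \<alpha> u (xs @ [x]) =
    (if idle lcb V0 \<alpha> (length xs) u (fed lcb V0 \<alpha> u xs)
     then fed lcb V0 \<alpha> u xs else fed lcb V0 \<alpha> u xs @ [x])"
  by (simp add: lcbce_state_snoc plays_baseline_iff_idle)

lemma select_lcbce:
  "select (lcbce \<AA> lcb \<pi>0 V0 \<alpha>) u xs =
    (if idle lcb V0 \<alpha> (length xs) u (fed lcb V0 \<alpha> u xs)
     then \<pi>0 else select \<AA> u (fed lcb V0 \<alpha> u xs))"
  by (simp add: lcbce_def plays_baseline_iff_idle)

lemma seed_lcbce [simp]: "seed (lcbce \<AA> lcb \<pi>0 V0 \<alpha>) = seed \<AA>"
  by (simp add: lcbce_def)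

text \<open>History spaces depend on an algorithm only through its seed law, which LCBCE shares with
  \<open>\<AA>\<close>.\<close>

lemma hist_measurable_lcbce [simp]:
  "hist_measurable M (lcbce \<AA> lcb \<pi>0 V0 \<alpha>) = hist_measurable M \<AA>"
  by (simp add: fun_eq_iff hist_measurable_def hist_space_def)

lemma hist_measurable_lcb:
  assumes "computable_bounds M \<AA> lcb"
  shows "hist_measurable M \<AA> (\<lambda>u ys. \<Sum>k = 1..length ys + 1. lcb u ys k) borel"
proof (rule hist_measurableI)
  fix n
  have "(\<lambda>z. lcb (fst z) (first_obs n (snd z)) k) \<in> borel_measurable (hist_space M \<AA> n)"
    if "k \<in> {1..n + 1}" for k
    using assms that by (simp add: computable_bounds_def case_prod_beta')
  then show "(\<lambda>z. \<Sum>k = 1..length (first_obs n (snd z)) + 1. lcb (fst z) (first_obs n (snd z)) k)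
      \<in> borel_measurable (hist_space M \<AA> n)"
    unfolding length_first_obs by (rule borel_measurable_sum)
qed

lemma hist_measurable_idle:
  assumes "computable_bounds M \<AA> lcb"
  shows "hist_measurable M \<AA> (idle lcb V0 \<alpha> n) (count_space UNIV)"
proof (rule hist_measurableI)
  fix m
  note hist_measurableD[OF hist_measurable_lcb[OF assms], of m, unfolded length_first_obs, measurable]
  show "Measurable.pred (hist_space M \<AA> m) (\<lambda>z. idle lcb V0 \<alpha> n (fst z) (first_obs m (snd z)))"
    unfolding idle_def plays_baseline_def prod.case length_first_obs by measurable
qed

section \<open>Measurability of the fed history\<close>

text \<open>
  The episodes appended to the fed history strengthen the induction: episode \<open>Suc n\<close> either joins
  them or is dropped.
\<close>

lemma measurable_fed_append:
  fixes M :: "('s, 'a) mdp" and \<AA> :: "('u, 's, 'a) algorithm"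
  assumes lcb: "computable_bounds M \<AA> lcb" and P: "hist_measurable M \<AA> P (count_space UNIV)"
  shows "Measurable.pred (hist_space M \<AA> (n + m))
    (\<lambda>z. P (fst z) (fed lcb V0 \<alpha> (fst z) (first_obs n (snd z)) @ map (snd z) [Suc n..<Suc (n + m)]))"
  using P
proof (induction n arbitrary: m P)
  case 0
  then show ?case using hist_measurableD[of M \<AA> P _ m] by (simp add: first_obs_def del: upt_Suc)
next
  case (Suc n)
  let ?H = "hist_space M \<AA> (Suc n + m)"
  let ?fed = "\<lambda>z. fed lcb V0 \<alpha> (fst z) (first_obs n (snd z))"
  \<comment> \<open>\<open>drop1\<close> deletes episode \<open>Suc n\<close> and shifts the later
    ones down, which is the case of a baseline episode; \<open>trunc\<close> keeps the episodes on
    which the decision depends.\<close>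
  define drop1 where "drop1 = (\<lambda>z. (fst z :: 'u, \<lambda>i\<in>{1..n + m}. if i \<le> n then snd z i else snd z (Suc i) :: ('s, 'a) trajectory))"
  define trunc where "trunc = (\<lambda>z. (fst z :: 'u, \<lambda>i\<in>{1..n + 0}. snd z i :: ('s, 'a) trajectory))"
  have drop1: "drop1 \<in> ?H \<rightarrow>\<^sub>M hist_space M \<AA> (n + m)"
    unfolding drop1_def
  proof (rule measurable_hist_space)
    fix i assume "i \<in> {1..n + m}"
    then show "(\<lambda>z. if i \<le> n then snd z i else snd z (Suc i)) \<in> ?H \<rightarrow>\<^sub>M traj_space M"
      by (cases "i \<le> n") (auto intro: measurable_hist_space_component)
  qed measurable
  have trunc: "trunc \<in> ?H \<rightarrow>\<^sub>M hist_space M \<AA> (n + 0)"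
    unfolding trunc_def by (rule measurable_hist_space) (auto intro: measurable_hist_space_component)
  have first: "first_obs n (snd (drop1 z)) = first_obs n (snd z)"
    "first_obs n (snd (trunc z)) = first_obs n (snd z)" for z
    by (rule first_obs_cong; simp add: drop1_def trunc_def)+
  have "fst (drop1 z) = fst z" "fst (trunc z) = fst z" for z
    by (simp_all add: drop1_def trunc_def)
  note simps = this first
  have shift: "map (snd (drop1 z)) [Suc n..<Suc (n + m)] = map (snd z) [Suc (Suc n)..<Suc (Suc n + m)]" for z
    by (rule nth_equalityI) (simp_all add: drop1_def del: upt_Suc)
  \<comment> \<open>The decision is itself a predicate of the fed history, so the induction
    hypothesis applies to it; this is why \<open>P\<close> is generalised.\<close>
  have [measurable]: "Measurable.pred ?H (\<lambda>z. idle lcb V0 \<alpha> n (fst z) (?fed z))"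
    using measurable_compose[OF trunc Suc.IH[OF hist_measurable_idle[OF lcb, of V0 \<alpha> n], of 0]]
    by (simp add: simps)
  have [measurable]: "Measurable.pred ?H (\<lambda>z. P (fst z) (?fed z @ map (snd z) [Suc (Suc n)..<Suc (Suc n + m)]))"
    using measurable_compose[OF drop1 Suc.IH[OF Suc.prems, of m]] by (simp only: simps shift)
  \<comment> \<open>A fed episode becomes the first appended one: the induction hypothesis with
    \<open>Suc m\<close> appended episodes.\<close>
  have [measurable]: "Measurable.pred ?H (\<lambda>z. P (fst z) (?fed z @ map (snd z) [Suc n..<Suc (Suc n + m)]))"
    using Suc.IH[OF Suc.prems, of "Suc m"] by (simp del: upt_Suc)
  have "P (fst z) (fed lcb V0 \<alpha> (fst z) (first_obs (Suc n) (snd z)) @ map (snd z) [Suc (Suc n)..<Suc (Suc n + m)])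
    \<longleftrightarrow> (if idle lcb V0 \<alpha> n (fst z) (?fed z)
         then P (fst z) (?fed z @ map (snd z) [Suc (Suc n)..<Suc (Suc n + m)])
         else P (fst z) (?fed z @ map (snd z) [Suc n..<Suc (Suc n + m)]))" for z
    by (simp add: first_obs_Suc fed_snoc upt_conv_Cons[of "Suc n"] del: upt_Suc)
  note cases = this
  show ?case unfolding cases by measurable
qed

text \<open>Membership of \<open>F\<close> in a measurable set is a predicate of the fed history,
  which reduces a general target to the predicate case. Values lie in the target space because fed
  trajectories are among the observed ones.\<close>

lemma hist_measurable_fed:
  assumes lcb: "computable_bounds M \<AA> lcb" and F: "hist_measurable M \<AA> F N"
  shows "hist_measurable M \<AA> (\<lambda>u xs. F u (fed lcb V0 \<alpha> u xs)) N"
proof (rule hist_measurableI, rule measurableI)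
  fix n z assume z: "z \<in> space (hist_space M \<AA> n)"
  then have "set (first_obs n (snd z)) \<subseteq> space (traj_space M)"
    using measurable_space[OF measurable_hist_space_component z] by (auto simp: first_obs_def simp del: upt_Suc)
  with set_fed_subset have "set (fed lcb V0 \<alpha> (fst z) (first_obs n (snd z))) \<subseteq> space (traj_space M)"
    by (rule subset_trans)
  with measurable_space[OF measurable_hist_space_fst z]
  show "F (fst z) (fed lcb V0 \<alpha> (fst z) (first_obs n (snd z))) \<in> space N"
    by (intro hist_measurable_space[OF F])
next
  fix n A assume A: "A \<in> sets N"
  have "hist_measurable M \<AA> (\<lambda>u ys. F u ys \<in> A) (count_space UNIV)"
    by (intro hist_measurableI pred_sets2[OF A] hist_measurableD[OF F])
  from measurable_fed_append[OF lcb this, where n = n and m = 0 and ?V0.0 = V0 and \<alpha> = \<alpha>]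
  have "Measurable.pred (hist_space M \<AA> n)
      (\<lambda>z. F (fst z) (fed lcb V0 \<alpha> (fst z) (first_obs n (snd z))) \<in> A)"
    by simp
  then show "(\<lambda>z. F (fst z) (fed lcb V0 \<alpha> (fst z) (first_obs n (snd z)))) -` A \<inter> space (hist_space M \<AA> n)
      \<in> sets (hist_space M \<AA> n)"
    by (simp add: pred_def vimage_def Int_def conj_commute)
qed

lemma traj_law_in_prob_algebra:
  assumes M: "is_mdp M" and \<pi>: "\<pi> \<in> policies M"
  shows "traj_law M \<pi> \<in> space (prob_algebra (traj_space M))"
proof -
  \<comment> \<open>A fixed policy is a kernel over a one-point parameter space.\<close>
  have "(\<lambda>_::unit. traj_law M \<pi>) \<in> count_space UNIV \<rightarrow>\<^sub>M prob_algebra (traj_space M)"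
  proof (rule measurable_traj_law[OF M])
    fix h assume "h \<in> {1..horizon M}"
    with \<pi> have [measurable]: "\<pi> h \<in> states M \<rightarrow>\<^sub>M prob_algebra (actions M)"
      by (simp add: policies_def)
    show "(\<lambda>(_::unit, s). \<pi> h s) \<in> count_space UNIV \<Otimes>\<^sub>M states M \<rightarrow>\<^sub>M prob_algebra (actions M)"
      by measurable
  qed
  from measurable_space[OF this, of "()"] show ?thesis by simp
qed

text \<open>Here \<open>c\<close> is the object attached to the baseline policy and \<open>F\<close>
  the one attached to the base algorithm; the trajectory laws are the intended instance.\<close>

lemma hist_measurable_lcbce_cases:
  assumes lcb: "computable_bounds M \<AA> lcb" and F: "hist_measurable M \<AA> F N" and c: "c \<in> space N"
  shows "hist_measurable M \<AA> (\<lambda>u xs. if idle lcb V0 \<alpha> (length xs) u (fed lcb V0 \<alpha> u xs)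
    then c else F u (fed lcb V0 \<alpha> u xs)) N"
proof (rule hist_measurableI)
  fix n
  note hist_measurableD[OF hist_measurable_fed[OF lcb F, where ?V0.0 = V0 and \<alpha> = \<alpha>], of n, measurable]
    hist_measurableD[OF hist_measurable_fed[OF lcb hist_measurable_idle[OF lcb, of V0 \<alpha> n], where ?V0.0 = V0 and \<alpha> = \<alpha>], of n, measurable]
    c[measurable]
  show "(\<lambda>z. if idle lcb V0 \<alpha> (length (first_obs n (snd z))) (fst z) (fed lcb V0 \<alpha> (fst z) (first_obs n (snd z)))
      then c else F (fst z) (fed lcb V0 \<alpha> (fst z) (first_obs n (snd z)))) \<in> hist_space M \<AA> n \<rightarrow>\<^sub>M N"
    unfolding length_first_obs by measurable
qed

lemma hist_measurable_traj_law_lcbce: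
  assumes "is_mdp M" "is_algorithm M \<AA>" "\<pi>0 \<in> policies M" "computable_bounds M \<AA> lcb"
  shows "hist_measurable M \<AA> (\<lambda>u xs. traj_law M (select (lcbce \<AA> lcb \<pi>0 V0 \<alpha>) u xs))
    (prob_algebra (traj_space M))"
  unfolding select_lcbce if_distrib[of "traj_law M"]
  using hist_measurable_lcbce_cases[OF assms(4) hist_measurable_traj_law[OF assms(1,2)]
      traj_law_in_prob_algebra[OF assms(1,3)]] .

lemma is_run_measurable:
  assumes "is_run M \<AA> \<Omega> U X" "hist_measurable M \<AA> F N"
  shows "(\<lambda>\<omega>. F (U \<omega>) (first_obs n (\<lambda>i. X i \<omega>))) \<in> \<Omega> \<rightarrow>\<^sub>M N"
  using assms(1) by (intro hist_measurable_compose[OF assms(2)]) (auto simp: is_run_def)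

lemma is_run_space:
  assumes "is_run M \<AA> \<Omega> U X" "\<omega> \<in> space \<Omega>"
  shows "U \<omega> \<in> space (seed \<AA>)" "set (first_obs n (\<lambda>i. X i \<omega>)) \<subseteq> space (traj_space M)"
  using assms by (auto simp: is_run_def first_obs_def simp del: upt_Suc dest: measurable_space)

section \<open>The martingale along LCBCE and the comparison of probabilities\<close>

text \<open>The martingale property: the conditional expectation of \<open>f\<close> at
  \<open>T\<close> fed episodes, given the current fed history, has constant mean along the episodes
  of LCBCE.\<close>

lemma nn_integral_expect_after_fed:
  fixes f :: "'u \<Rightarrow> ('s, 'a) trajectory list \<Rightarrow> ennreal"
  assumes M: "is_mdp M" and \<AA>: "is_algorithm M \<AA>" and \<pi>0: "\<pi>0 \<in> policies M"
    and lcb: "computable_bounds M \<AA> lcb"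
    and run: "is_run M (lcbce \<AA> lcb \<pi>0 V0 \<alpha>) \<Omega> U X"
    and f: "hist_measurable M \<AA> f borel" and "n \<le> T"
  shows "(\<integral>\<^sup>+\<omega>. expect_after M \<AA> f (T - length (fed lcb V0 \<alpha> (U \<omega>) (first_obs n (\<lambda>i. X i \<omega>))))
      (U \<omega>) (fed lcb V0 \<alpha> (U \<omega>) (first_obs n (\<lambda>i. X i \<omega>))) \<partial>\<Omega>) =
    (\<integral>\<^sup>+\<omega>. expect_after M \<AA> f T (U \<omega>) [] \<partial>\<Omega>)"
  using \<open>n \<le> T\<close>
proof (induction n)
  case (Suc n)
  let ?B = "lcbce \<AA> lcb \<pi>0 V0 \<alpha>"
  let ?fed = "fed lcb V0 \<alpha>"
  let ?g = "\<lambda>u xs. expect_after M \<AA> f (T - length (?fed u xs)) u (?fed u xs)"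
  note K = hist_measurable_traj_law[OF M \<AA>]
  note KB = hist_measurable_traj_law_lcbce[OF M \<AA> \<pi>0 lcb, where ?V0.0 = V0 and \<alpha> = \<alpha>]
  have "hist_measurable M \<AA> (\<lambda>u ys. expect_after M \<AA> f (T - length ys) u ys) borel"
    using hist_measurable_expect_after[OF K f] by (simp add: hist_measurable_def)
  from hist_measurable_fed[OF lcb this] have g: "hist_measurable M \<AA> ?g borel" .
  have "(\<integral>\<^sup>+\<omega>. ?g (U \<omega>) (first_obs (Suc n) (\<lambda>i. X i \<omega>)) \<partial>\<Omega>) =
      (\<integral>\<^sup>+\<omega>. (\<integral>\<^sup>+y. ?g (U \<omega>) (first_obs n (\<lambda>i. X i \<omega>) @ [y])
        \<partial>traj_law M (select ?B (U \<omega>) (first_obs n (\<lambda>i. X i \<omega>)))) \<partial>\<Omega>)"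
    by (rule nn_integral_run_step[OF run]) (simp_all add: KB g)
  also have "\<dots> = (\<integral>\<^sup>+\<omega>. ?g (U \<omega>) (first_obs n (\<lambda>i. X i \<omega>)) \<partial>\<Omega>)"
  proof (rule nn_integral_cong)
    fix \<omega> assume \<omega>: "\<omega> \<in> space \<Omega>"
    define u where "u = U \<omega>"
    define xs where "xs = first_obs n (\<lambda>i. X i \<omega>)"
    have u: "u \<in> space (seed \<AA>)" "set xs \<subseteq> space (traj_space M)"
      using is_run_space[OF run \<omega>] by (simp_all add: u_def xs_def)
    have xs: "length xs = n" by (simp add: xs_def)
    show "(\<integral>\<^sup>+y. ?g u (xs @ [y]) \<partial>traj_law M (select ?B u xs)) = ?g u xs"
    proof (cases "idle lcb V0 \<alpha> n u (?fed u xs)")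
      case True
      \<comment> \<open>A baseline episode leaves the fed history alone, so a constant is integrated
        against a probability.\<close>
      have "prob_space (traj_law M (select ?B u xs))"
        using hist_measurable_space[OF KB u] by (simp add: space_prob_algebra)
      then show ?thesis
        using True by (simp add: fed_snoc xs prob_space.emeasure_space_1)
    next
      case False
      \<comment> \<open>At most \<open>n < T\<close> episodes have been fed, so at least one remains
        and \<open>expect_after\<close> unfolds once, against the very law from which LCBCE draws
        this episode.\<close>
      have "T - length (?fed u xs) = Suc (T - Suc (length (?fed u xs)))"
        using Suc.prems length_fed_le[of lcb V0 \<alpha> u xs] xs by simp
      then show ?thesis
        using False by (simp add: fed_snoc select_lcbce xs)
    qed
  qed
  also have "\<dots> = (\<integral>\<^sup>+\<omega>. expect_after M \<AA> f T (U \<omega>) [] \<partial>\<Omega>)"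
    using Suc by simp
  finally show ?case .
qed simp

lemma hist_measurable_of_bool:
  assumes "hist_measurable M \<AA> P (count_space UNIV)"
  shows "hist_measurable M \<AA> (\<lambda>u ys. of_bool (P u ys) :: ennreal) borel"
  by (rule hist_measurableI, rule measurable_compose[OF hist_measurableD[OF assms]]) simp

lemma nn_integral_of_bool:
  assumes "Measurable.pred M P"
  shows "(\<integral>\<^sup>+x. of_bool (P x) \<partial>M) = emeasure M {x \<in> space M. P x}"
proof -
  have "(\<integral>\<^sup>+x. of_bool (P x) \<partial>M) = (\<integral>\<^sup>+x. indicator {x \<in> space M. P x} x \<partial>M)"
    by (rule nn_integral_cong) (simp add: indicator_def)
  with assms show ?thesis by (simp add: pred_def)
qed

lemma prob_le_prob_fed:
  assumes M: "is_mdp M" and \<AA>: "is_algorithm M \<AA>" and \<pi>0: "\<pi>0 \<in> policies M"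
    and lcb: "computable_bounds M \<AA> lcb"
    and run: "is_run M \<AA> \<Omega> U X"
    and run': "is_run M (lcbce \<AA> lcb \<pi>0 V0 \<alpha>) \<Omega>' U' X'"
    and P: "hist_measurable M \<AA> P (count_space UNIV)"
    and closed: "\<And>u ys y. P u (ys @ [y]) \<Longrightarrow> P u ys"
  shows "\<P>(\<omega> in \<Omega>. P (U \<omega>) (first_obs T (\<lambda>i. X i \<omega>))) \<le>
    \<P>(\<omega> in \<Omega>'. P (U' \<omega>) (fed lcb V0 \<alpha> (U' \<omega>) (first_obs T (\<lambda>i. X' i \<omega>))))"
proof -
  let ?f = "\<lambda>u ys. of_bool (P u ys) :: ennreal"
  let ?ys = "\<lambda>\<omega>. fed lcb V0 \<alpha> (U' \<omega>) (first_obs T (\<lambda>i. X' i \<omega>))"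
  interpret \<Omega>: prob_space \<Omega> using run by (simp add: is_run_def)
  interpret \<Omega>': prob_space \<Omega>' using run' by (simp add: is_run_def)
  note f = hist_measurable_of_bool[OF P]
  note K = hist_measurable_traj_law[OF M \<AA>]
  note e = hist_measurable_expect_after[OF K f, of T]
  have "emeasure \<Omega> {\<omega> \<in> space \<Omega>. P (U \<omega>) (first_obs T (\<lambda>i. X i \<omega>))} =
      (\<integral>\<^sup>+\<omega>. ?f (U \<omega>) (first_obs (0 + T) (\<lambda>i. X i \<omega>)) \<partial>\<Omega>)"
    by (simp add: nn_integral_of_bool[OF is_run_measurable[OF run P]])
  also have "\<dots> = (\<integral>\<^sup>+\<omega>. expect_after M \<AA> ?f T (U \<omega>) [] \<partial>\<Omega>)"
    by (subst nn_integral_expect_after[OF run K f, symmetric]) simp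
  \<comment> \<open>The passage between the two runs takes place at the empty history, where only
    the common seed law matters.\<close>
  also have "\<dots> = (\<integral>\<^sup>+\<omega>. expect_after M \<AA> ?f T (U' \<omega>) [] \<partial>\<Omega>')"
    using nn_integral_seed[OF run e] nn_integral_seed[OF run', of "expect_after M \<AA> ?f T"] e by simp
  also have "\<dots> = (\<integral>\<^sup>+\<omega>. expect_after M \<AA> ?f (T - length (?ys \<omega>)) (U' \<omega>) (?ys \<omega>) \<partial>\<Omega>')"
    by (rule nn_integral_expect_after_fed[OF M \<AA> \<pi>0 lcb run' f order_refl, symmetric])
  \<comment> \<open>The fed history may be shorter than \<open>T\<close>; inheritance of
    \<open>P\<close> by prefixes bounds the expectation by the indicator at the shorter
    history.\<close>
  also have "\<dots> \<le> (\<integral>\<^sup>+\<omega>. ?f (U' \<omega>) (?ys \<omega>) \<partial>\<Omega>')"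
  proof (intro nn_integral_mono expect_after_le_indicator[OF K closed])
    fix \<omega> assume "\<omega> \<in> space \<Omega>'"
    note \<omega> = is_run_space[OF run' this]
    show "U' \<omega> \<in> space (seed \<AA>)" using \<omega>(1) by simp
    show "set (?ys \<omega>) \<subseteq> space (traj_space M)" using set_fed_subset \<omega>(2) by (rule subset_trans)
  qed
  also have "\<dots> = emeasure \<Omega>' {\<omega> \<in> space \<Omega>'. P (U' \<omega>) (?ys \<omega>)}"
    by (rule nn_integral_of_bool, rule is_run_measurable[OF run', of "\<lambda>u xs. P u (fed lcb V0 \<alpha> u xs)"])
      (simp add: hist_measurable_fed[OF lcb P])
  finally show ?thesis
    by (simp add: \<Omega>.emeasure_eq_measure \<Omega>'.emeasure_eq_measure)
qed

section \<open>Regret of LCBCE\<close>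

text \<open>Regret as a function of a seed and a list, so that it makes sense both along a run of
  \<open>\<AA>\<close> and along the history fed to \<open>\<AA>\<close> by LCBCE.\<close>

definition regret_on ::
  "('s, 'a) mdp \<Rightarrow> ('u, 's, 'a) algorithm \<Rightarrow> 'u \<Rightarrow> ('s, 'a) trajectory list \<Rightarrow> nat \<Rightarrow> real" where
  "regret_on M \<AA> u ys t = (\<Sum>k = 1..t. opt_value M - policy_value M (select \<AA> u (take (k - 1) ys)))"

definition lcb_error_on ::
  "('s, 'a) mdp \<Rightarrow> ('u, 's, 'a) algorithm \<Rightarrow> ('u, 's, 'a) lower_bounds \<Rightarrow> 'u \<Rightarrow>
    ('s, 'a) trajectory list \<Rightarrow> nat \<Rightarrow> real" where
  "lcb_error_on M \<AA> lcb u ys t =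
    (\<Sum>k = 1..t. policy_value M (select \<AA> u (take (k - 1) ys)) - lcb u (take (t - 1) ys) k)"

text \<open>The quantities at time \<open>t\<close> depend on \<open>t - 1\<close> trajectories
  only, so a history determines them one step beyond its length. LCBCE uses that extra step when it
  decides about a policy that has not been played yet.\<close>

definition within_bounds ::
  "('s, 'a) mdp \<Rightarrow> ('u, 's, 'a) algorithm \<Rightarrow> ('u, 's, 'a) lower_bounds \<Rightarrow> (nat \<Rightarrow> real) \<Rightarrow> (nat \<Rightarrow> real) \<Rightarrow>
    'u \<Rightarrow> ('s, 'a) trajectory list \<Rightarrow> bool" where
  "within_bounds M \<AA> lcb b1 b2 u ys \<longleftrightarrow> (\<forall>t\<in>{1..length ys + 1}.
    regret_on M \<AA> u ys t \<le> b1 t \<and> lcb_error_on M \<AA> lcb u ys t \<le> b2 t)"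

lemma regret_eq_regret_on:
  "t \<le> Suc n \<Longrightarrow> regret M \<AA> U X t \<omega> = regret_on M \<AA> (U \<omega>) (first_obs n (\<lambda>i. X i \<omega>)) t"
  by (auto simp: regret_def regret_on_def played_def observed_def take_first_obs min_def intro!: sum.cong)

lemma lcb_error_eq_lcb_error_on:
  "t \<le> Suc n \<Longrightarrow>
    lcb_error M \<AA> lcb U X t \<omega> = lcb_error_on M \<AA> lcb (U \<omega>) (first_obs n (\<lambda>i. X i \<omega>)) t"
  by (auto simp: lcb_error_def lcb_error_on_def played_def observed_def take_first_obs min_def
      intro!: sum.cong)

lemma regret_on_append:
  "t \<le> Suc (length ys) \<Longrightarrow> regret_on M \<AA> u (ys @ zs) t = regret_on M \<AA> u ys t"
  by (auto simp: regret_on_def intro!: sum.cong)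

lemma lcb_error_on_append:
  "t \<le> Suc (length ys) \<Longrightarrow> lcb_error_on M \<AA> lcb u (ys @ zs) t = lcb_error_on M \<AA> lcb u ys t"
  by (auto simp: lcb_error_on_def intro!: sum.cong)

lemma regret_on_Suc_length:
  "regret_on M \<AA> u (ys @ [y]) (Suc (length ys)) =
    regret_on M \<AA> u ys (length ys) + (opt_value M - policy_value M (select \<AA> u ys))"
  by (subst regret_on_append) (simp_all add: regret_on_def)

text \<open>Inheritance by prefixes, the closure property required by
  \<open>prob_le_prob_fed\<close>.\<close>

lemma within_bounds_appendD:
  assumes "within_bounds M \<AA> lcb b1 b2 u (ys @ zs)"
  shows "within_bounds M \<AA> lcb b1 b2 u ys"
  unfolding within_bounds_def
proof
  fix t assume t: "t \<in> {1..length ys + 1}"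
  then have "t \<in> {1..length (ys @ zs) + 1}" by simp
  with assms have "regret_on M \<AA> u (ys @ zs) t \<le> b1 t \<and> lcb_error_on M \<AA> lcb u (ys @ zs) t \<le> b2 t"
    unfolding within_bounds_def by blast
  with t show "regret_on M \<AA> u ys t \<le> b1 t \<and> lcb_error_on M \<AA> lcb u ys t \<le> b2 t"
    by (simp add: regret_on_append lcb_error_on_append)
qed

lemma hist_measurable_policy_value:
  assumes "is_mdp M" "hist_measurable M \<AA> (\<lambda>u ys. traj_law M (pol u ys)) (prob_algebra (traj_space M))"
  shows "hist_measurable M \<AA> (\<lambda>u ys. policy_value M (pol u ys)) borel"
  by (rule hist_measurableI, rule borel_measurable_policy_value[OF assms(1)], rule hist_measurableD[OF assms(2)])

lemma hist_measurable_regret_on: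
  assumes M: "is_mdp M"
    and K: "hist_measurable M \<AA> (\<lambda>u ys. traj_law M (select \<BB> u ys)) (prob_algebra (traj_space M))"
  shows "hist_measurable M \<AA> (\<lambda>u ys. regret_on M \<BB> u ys t) borel"
proof (rule hist_measurableI)
  fix n
  note hist_measurableD[OF hist_measurable_take[OF hist_measurable_policy_value[OF M K]], measurable]
  show "(\<lambda>z. regret_on M \<BB> (fst z) (first_obs n (snd z)) t) \<in> borel_measurable (hist_space M \<AA> n)"
    unfolding regret_on_def by measurable
qed

lemma hist_measurable_within_bounds:
  fixes M :: "('s, 'a) mdp" and \<AA> :: "('u, 's, 'a) algorithm"
  assumes M: "is_mdp M" and \<AA>: "is_algorithm M \<AA>" and lcb: "computable_bounds M \<AA> lcb"
  shows "hist_measurable M \<AA> (within_bounds M \<AA> lcb b1 b2) (count_space UNIV)"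
proof (rule hist_measurableI)
  fix n
  note K = hist_measurable_traj_law[OF M \<AA>]
  note hist_measurableD[OF hist_measurable_take[OF hist_measurable_policy_value[OF M K]], measurable]
    hist_measurableD[OF hist_measurable_regret_on[OF M K], measurable]
  have [measurable]: "(\<lambda>z. lcb_error_on M \<AA> lcb (fst z) (first_obs n (snd z)) t) \<in> borel_measurable (hist_space M \<AA> n)"
    if t: "t \<in> {1..n + 1}" for t
  proof -
    \<comment> \<open>For \<open>t - 1 \<le> n\<close> the truncation has exactly
      \<open>t - 1\<close> entries, so the number of summands is the constant
      \<open>t\<close>.\<close>
    have len: "length (take (t - 1) (first_obs n x)) + 1 = t" for x :: "nat \<Rightarrow> ('s, 'a) trajectory"
      using t by auto
    from hist_measurableD[OF hist_measurable_take[OF hist_measurable_lcb[OF lcb]], of "t - 1" n]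
    have [measurable]: "(\<lambda>z. \<Sum>k = 1..t. lcb (fst z) (take (t - 1) (first_obs n (snd z))) k)
        \<in> borel_measurable (hist_space M \<AA> n)"
      by (simp only: len)
    show ?thesis
      unfolding lcb_error_on_def sum_subtractf by measurable
  qed
  show "Measurable.pred (hist_space M \<AA> n) (\<lambda>z. within_bounds M \<AA> lcb b1 b2 (fst z) (first_obs n (snd z)))"
    unfolding within_bounds_def length_first_obs by (intro pred_intros_finite finite_atLeastAtMost) measurable
qed

section \<open>The deterministic regret bound\<close>

text \<open>Every episode of LCBCE either costs the gap of the baseline or is the next episode of
  \<open>\<AA>\<close>.\<close>

lemma regret_on_lcbce:
  fixes lcb :: "('u, 's, 'a) lower_bounds" and V0 \<alpha> :: real
  defines "ys \<equiv> \<lambda>u xs. fed lcb V0 \<alpha> u xs"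
  shows "regret_on M (lcbce \<AA> lcb \<pi>0 V0 \<alpha>) u xs (length xs) =
    real (length xs - length (ys u xs)) * (opt_value M - policy_value M \<pi>0) +
    regret_on M \<AA> u (ys u xs) (length (ys u xs))"
proof (induction xs rule: rev_induct)
  case Nil
  then show ?case by (simp add: ys_def regret_on_def)
next
  case (snoc x xs)
  have "length (ys u xs) \<le> length xs"
    by (simp add: ys_def length_fed_le)
  with snoc show ?case
    by (auto simp: regret_on_Suc_length select_lcbce fed_snoc ys_def Suc_diff_le algebra_simps)
qed

text \<open>Here \<open>n\<close> counts the episodes fed before the last baseline episode; the
  budget at that moment comes from all baseline episodes but that one. Using \<open>take n\<close>
  keeps the inequality unchanged when later episodes are fed.\<close>

lemma ex_last_idle:
  fixes lcb :: "('u, 's, 'a) lower_bounds" and V0 \<alpha> :: real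
  defines "ys \<equiv> \<lambda>u xs. fed lcb V0 \<alpha> u xs"
  assumes "length (ys u xs) < length xs"
  shows "\<exists>n<length xs. n \<le> length (ys u xs) \<and>
    (real (length xs - length (ys u xs)) - 1) * (\<alpha> * V0) <
      real (n + 1) * (1 - \<alpha>) * V0 - (\<Sum>k = 1..n + 1. lcb u (take n (ys u xs)) k)"
  using assms(2)
proof (induction xs rule: rev_induct)
  case (snoc x xs)
  have le: "length (ys u xs) \<le> length xs"
    by (simp add: ys_def length_fed_le)
  show ?case
  proof (cases "idle lcb V0 \<alpha> (length xs) u (ys u xs)")
    case True
    then have ys: "ys u (xs @ [x]) = ys u xs"
      by (simp add: ys_def fed_snoc)
    from True le show ?thesis
      by (intro exI[of _ "length (ys u xs)"])
        (simp add: ys idle_def plays_baseline_def Suc_diff_le del: sum.cl_ivl_Suc)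
  next
    case False
    then have ys: "ys u (xs @ [x]) = ys u xs @ [x]"
      by (simp add: ys_def fed_snoc)
    with snoc.prems have "length (ys u xs) < length xs" by simp
    from snoc.IH[OF this] obtain n where "n < length xs" "n \<le> length (ys u xs)"
      "(real (length xs - length (ys u xs)) - 1) * (\<alpha> * V0) <
        real (n + 1) * (1 - \<alpha>) * V0 - (\<Sum>k = 1..n + 1. lcb u (take n (ys u xs)) k)"
      by blast
    then show ?thesis
      by (intro exI[of _ n]) (simp add: ys del: sum.cl_ivl_Suc)
  qed
qed simp

text \<open>The policy values cancel when regret and confidence error are added, leaving the optimal
  value minus the lower bounds.\<close>

lemma sum_lcb_eq:
  assumes "n \<le> length ys"
  shows "(\<Sum>k = 1..n + 1. lcb u (take n ys) k) =
    real (n + 1) * opt_value M - regret_on M \<AA> u ys (n + 1) - lcb_error_on M \<AA> lcb u ys (n + 1)"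
  by (simp add: regret_on_def lcb_error_on_def sum_subtractf del: sum.cl_ivl_Suc)

text \<open>
  If the baseline is played at all, the decision rule at its last use makes \<open>K\<close> exceed \<open>\<Delta>\<close>; this
  absorbs the \<open>\<Delta>\<close> lost by the last of the \<open>N\<close> baseline episodes.
\<close>

lemma baseline_regret_bound:
  fixes a \<Delta> K N s :: real
  assumes a: "0 < a" and \<Delta>: "0 \<le> \<Delta>" and s: "1 \<le> s" and N: "1 \<le> N"
    and decision: "(N - 1) * a < K * s - s\<^sup>2 * (a + \<Delta>)"
  shows "N * \<Delta> \<le> K + K\<^sup>2 * \<Delta> / (a * (a + \<Delta>))"
proof -
  define b where "b = a + \<Delta>"
  have b: "0 < b" "a \<le> b" "\<Delta> \<le> b" using a \<Delta> by (auto simp: b_def)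
  \<comment> \<open>In the application \<open>s\<close> is the square root of the number of episodes
    \<open>m\<close>. Nonnegativity of the left side of \<open>decision\<close> gives
    \<open>s * b < K\<close>, and \<open>s \<ge> 1\<close> turns this into a bound on
    \<open>\<Delta>\<close>.\<close>
  have "0 \<le> (N - 1) * a" using N a by simp
  with decision have "s * (s * b) < s * K"
    by (simp add: b_def power2_eq_square algebra_simps)
  then have "s * b < K" using s by simp
  moreover have "b \<le> s * b" using mult_right_mono[OF s, of b] b by simp
  ultimately have "\<Delta> \<le> K" using b by linarith
  have "(N - 1) * a * b \<le> (K * s - s\<^sup>2 * b) * b"
    using decision b by (intro mult_right_mono) (auto simp: b_def)
  also have "\<dots> \<le> K\<^sup>2"
  proof -
    \<comment> \<open>Completing the square maximises the quadratic in \<open>s * b\<close> without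
      calculus.\<close>
    have "4 * (K\<^sup>2 - (K * s - s\<^sup>2 * b) * b) = (2 * K - s * b)\<^sup>2 + 3 * (s * b)\<^sup>2"
      by algebra
    moreover have "0 \<le> (2 * K - s * b)\<^sup>2 + 3 * (s * b)\<^sup>2" by simp
    ultimately have "0 \<le> 4 * (K\<^sup>2 - (K * s - s\<^sup>2 * b) * b)" by (simp only:)
    then show ?thesis by (simp only: zero_le_mult_iff) simp
  qed
  finally have "N - 1 \<le> K\<^sup>2 / (a * b)"
    using a b by (simp add: pos_le_divide_eq mult.assoc)
  then have "(N - 1) * \<Delta> \<le> K\<^sup>2 / (a * b) * \<Delta>"
    using \<Delta> by (rule mult_right_mono)
  moreover have "(N - 1) * \<Delta> = N * \<Delta> - \<Delta>"
    by (simp add: left_diff_distrib)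
  moreover have "K\<^sup>2 / (a * b) * \<Delta> = K\<^sup>2 * \<Delta> / (a * (a + \<Delta>))"
    by (simp add: b_def)
  ultimately show ?thesis using \<open>\<Delta> \<le> K\<close> by linarith
qed

text \<open>The regret splits into the baseline part \<open>N * \<Delta>\<close> and the regret of
  \<open>\<AA>\<close> on the fed history. Each contributes one \<open>K * sqrt (length xs)\<close>,
  whence the factor 2.\<close>

lemma regret_on_lcbce_le:
  fixes lcb :: "('u, 's, 'a) lower_bounds" and V0 \<alpha> :: real
  defines "ys \<equiv> \<lambda>u xs. fed lcb V0 \<alpha> u xs"
  assumes V0: "V0 = policy_value M \<pi>0" "0 < \<alpha> * V0" "V0 \<le> opt_value M"
    and bounds: "within_bounds M \<AA> lcb b1 b2 u (ys u xs)"
    and K: "0 \<le> K" "\<And>t. 1 \<le> t \<Longrightarrow> t \<le> length xs \<Longrightarrow> b1 t \<le> K * sqrt t"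
      "\<And>t. 1 \<le> t \<Longrightarrow> t \<le> length xs \<Longrightarrow> b1 t + b2 t \<le> K * sqrt t"
  shows "regret_on M (lcbce \<AA> lcb \<pi>0 V0 \<alpha>) u xs (length xs) \<le>
    2 * K * sqrt (length xs) +
    K\<^sup>2 * (opt_value M - V0) / (\<alpha> * V0 * (\<alpha> * V0 + (opt_value M - V0)))"
proof -
  define \<Delta> where "\<Delta> = opt_value M - V0"
  define N where "N = real (length xs - length (ys u xs))"
  define m where "m = length (ys u xs)"
  have m: "m \<le> length xs" by (simp add: m_def ys_def length_fed_le)
  have \<Delta>: "0 \<le> \<Delta>" using V0 by (simp add: \<Delta>_def)
  have frac: "0 \<le> K\<^sup>2 * \<Delta> / (\<alpha> * V0 * (\<alpha> * V0 + \<Delta>))"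
    using V0 \<Delta> by simp
  have base: "N * \<Delta> + regret_on M \<AA> u (ys u xs) m = regret_on M (lcbce \<AA> lcb \<pi>0 V0 \<alpha>) u xs (length xs)"
    by (simp add: regret_on_lcbce ys_def N_def m_def \<Delta>_def V0(1))
  have inner: "regret_on M \<AA> u (ys u xs) m \<le> K * sqrt (length xs)"
  \<comment> \<open>\<open>within_bounds\<close> speaks of times from 1 on, so an empty fed history
    is treated apart.\<close>
  proof (cases "m = 0")
    case True
    then show ?thesis using K(1) by (simp add: regret_on_def)
  next
    case False
    then have "m \<in> {1..length (ys u xs) + 1}" by (simp add: m_def Suc_le_eq)
    with bounds have "regret_on M \<AA> u (ys u xs) m \<le> b1 m"
      unfolding within_bounds_def by blast
    also have "\<dots> \<le> K * sqrt m" using False m by (intro K) auto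
    also have "\<dots> \<le> K * sqrt (length xs)" using m K(1) by (intro mult_left_mono) auto
    finally show ?thesis .
  qed
  have "N * \<Delta> \<le> K * sqrt (length xs) + K\<^sup>2 * \<Delta> / (\<alpha> * V0 * (\<alpha> * V0 + \<Delta>))"
  proof (cases "m < length xs")
    case False
    then show ?thesis using frac K(1) m by (simp add: N_def m_def)
  next
    case True
    from ex_last_idle[OF True[unfolded m_def ys_def]] obtain n where
      n: "n < length xs" "n \<le> length (ys u xs)" and
      last: "(N - 1) * (\<alpha> * V0) <
        real (n + 1) * (1 - \<alpha>) * V0 - (\<Sum>k = 1..n + 1. lcb u (take n (ys u xs)) k)"
      unfolding N_def ys_def by blast
    \<comment> \<open>The refused policy is number \<open>n + 1\<close>, possibly one beyond the fed
      history; \<open>n < length xs\<close> keeps it in the range where \<open>K\<close> controls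
      \<open>b1\<close> and \<open>b2\<close>.\<close>
    have "n + 1 \<in> {1..length (ys u xs) + 1}" using n by simp
    with bounds have "regret_on M \<AA> u (ys u xs) (n + 1) + lcb_error_on M \<AA> lcb u (ys u xs) (n + 1)
        \<le> b1 (n + 1) + b2 (n + 1)"
      unfolding within_bounds_def by (intro add_mono) blast+
    also have "\<dots> \<le> K * sqrt (real (n + 1))" using n by (intro K) auto
    finally have "real (n + 1) * opt_value M - K * sqrt (real (n + 1)) \<le>
        (\<Sum>k = 1..n + 1. lcb u (take n (ys u xs)) k)"
      unfolding sum_lcb_eq[OF n(2), where M = M and \<AA> = \<AA>] by simp
    \<comment> \<open>Substituting \<open>opt_value M = V0 + \<Delta>\<close> turns
      \<open>(1 - \<alpha>) * V0 - opt_value M\<close> into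
      \<open>- (\<alpha> * V0 + \<Delta>)\<close>.\<close>
    with last have "(N - 1) * (\<alpha> * V0) < K * sqrt (real (n + 1)) -
        real (n + 1) * (\<alpha> * V0 + \<Delta>)"
      by (simp add: \<Delta>_def algebra_simps)
    then have decision: "(N - 1) * (\<alpha> * V0) < K * sqrt (real (n + 1)) -
        (sqrt (real (n + 1)))\<^sup>2 * (\<alpha> * V0 + \<Delta>)"
      by simp
    have "N * \<Delta> \<le> K + K\<^sup>2 * \<Delta> / (\<alpha> * V0 * (\<alpha> * V0 + \<Delta>))"
      by (rule baseline_regret_bound[OF V0(2) \<Delta> _ _ decision]) (use True in \<open>auto simp: N_def m_def\<close>)
    \<comment> \<open>Some episode was played, so the stray \<open>K\<close> is absorbed into the
      square-root term.\<close>
    moreover have "K \<le> K * sqrt (length xs)"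
      using K(1) True by (cases "length xs") (auto simp: mult_le_cancel_left1)
    ultimately show ?thesis by linarith
  qed
  with inner base show ?thesis by (simp add: \<Delta>_def)
qed

section \<open>From the deterministic bound to probabilities\<close>

lemma prob_regret_lcbce:
  fixes b1 b2 :: "nat \<Rightarrow> real"
  assumes V0_def: "V0 = policy_value M \<pi>0" and M: "is_mdp M" and \<AA>: "is_algorithm M \<AA>" and \<pi>0: "\<pi>0 \<in> policies M"
    and lcb: "computable_bounds M \<AA> lcb" and V0: "0 < \<alpha> * V0"
    and run: "is_run M \<AA> \<Omega> U X"
    and run': "is_run M (lcbce \<AA> lcb \<pi>0 V0 \<alpha>) \<Omega>' U' X'"
    and K: "0 \<le> K" "\<And>t. 1 \<le> t \<Longrightarrow> t \<le> T \<Longrightarrow> b1 t \<le> K * sqrt t"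
      "\<And>t. 1 \<le> t \<Longrightarrow> t \<le> T \<Longrightarrow> b1 t + b2 t \<le> K * sqrt t"
    and R: "2 * K * sqrt T + K\<^sup>2 * (opt_value M - V0) / (\<alpha> * V0 * (\<alpha> * V0 + (opt_value M - V0))) \<le> R"
  shows "\<P>(\<omega> in \<Omega>. (\<forall>t\<ge>1. regret M \<AA> U X t \<omega> \<le> b1 t) \<and> (\<forall>t\<ge>1. lcb_error M \<AA> lcb U X t \<omega> \<le> b2 t)) \<le>
    \<P>(\<omega> in \<Omega>'. regret M (lcbce \<AA> lcb \<pi>0 V0 \<alpha>) U' X' T \<omega> \<le> R)"
proof -
  interpret \<Omega>: prob_space \<Omega> using run by (simp add: is_run_def)
  interpret \<Omega>': prob_space \<Omega>' using run' by (simp add: is_run_def)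
  let ?P = "within_bounds M \<AA> lcb b1 b2"
  let ?B = "lcbce \<AA> lcb \<pi>0 V0 \<alpha>"
  let ?xs = "\<lambda>\<omega>. first_obs T (\<lambda>i. X' i \<omega>)"
  note P = hist_measurable_within_bounds[OF M \<AA> lcb, of b1 b2]
  note KB = hist_measurable_traj_law_lcbce[OF M \<AA> \<pi>0 lcb, of V0 \<alpha>]
  have le: "V0 \<le> opt_value M"
    unfolding V0_def by (rule policy_value_le_opt_value[OF M \<pi>0])
  have [measurable]: "Measurable.pred \<Omega> (\<lambda>\<omega>. ?P (U \<omega>) (first_obs T (\<lambda>i. X i \<omega>)))"
    by (rule is_run_measurable[OF run P])
  have "\<P>(\<omega> in \<Omega>. (\<forall>t\<ge>1. regret M \<AA> U X t \<omega> \<le> b1 t) \<and> (\<forall>t\<ge>1. lcb_error M \<AA> lcb U X t \<omega> \<le> b2 t)) \<le>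
      \<P>(\<omega> in \<Omega>. ?P (U \<omega>) (first_obs T (\<lambda>i. X i \<omega>)))"
  \<comment> \<open>The event for all times is contained in the event for times up to
    \<open>T + 1\<close>, which depends on finitely many episodes and is measurable.\<close>
  proof (rule \<Omega>.finite_measure_mono)
    show "{\<omega> \<in> space \<Omega>. (\<forall>t\<ge>1. regret M \<AA> U X t \<omega> \<le> b1 t) \<and> (\<forall>t\<ge>1. lcb_error M \<AA> lcb U X t \<omega> \<le> b2 t)}
        \<subseteq> {\<omega> \<in> space \<Omega>. ?P (U \<omega>) (first_obs T (\<lambda>i. X i \<omega>))}"
      by (auto simp: within_bounds_def regret_eq_regret_on[of _ T] lcb_error_eq_lcb_error_on[of _ T])
  qed measurable
  also have "\<dots> \<le> \<P>(\<omega> in \<Omega>'. ?P (U' \<omega>) (fed lcb V0 \<alpha> (U' \<omega>) (?xs \<omega>)))"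
    by (rule prob_le_prob_fed[OF M \<AA> \<pi>0 lcb run run' P within_bounds_appendD])
  also have "\<dots> \<le> \<P>(\<omega> in \<Omega>'. regret M ?B U' X' T \<omega> \<le> R)"
  proof (rule \<Omega>'.finite_measure_mono)
    show "{\<omega> \<in> space \<Omega>'. ?P (U' \<omega>) (fed lcb V0 \<alpha> (U' \<omega>) (?xs \<omega>))} \<subseteq>
        {\<omega> \<in> space \<Omega>'. regret M ?B U' X' T \<omega> \<le> R}"
    proof safe
      fix \<omega> assume "?P (U' \<omega>) (fed lcb V0 \<alpha> (U' \<omega>) (?xs \<omega>))"
      from regret_on_lcbce_le[OF V0_def V0 le this, of K] K R
      show "regret M ?B U' X' T \<omega> \<le> R"
        by (simp add: regret_eq_regret_on[of T T])
    qed
    have [measurable]: "(\<lambda>\<omega>. regret M ?B U' X' T \<omega>) \<in> borel_measurable \<Omega>'"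
      unfolding regret_eq_regret_on[of T T, OF le_SucI[OF order_refl]]
      using hist_measurable_regret_on[OF M KB] by (intro is_run_measurable[OF run', of "\<lambda>u ys. regret_on M ?B u ys T"]) simp
    show "{\<omega> \<in> space \<Omega>'. regret M ?B U' X' T \<omega> \<le> R} \<in> sets \<Omega>'"
      by measurable
  qed
  finally show ?thesis .
qed

text \<open>A union bound. A non-measurable set has measure 0 by convention, so the positive lower
  bound \<open>1 - \<delta>\<close> forces both events to be measurable.\<close>

lemma (in prob_space) prob_conj_ge:
  assumes "\<P>(\<omega> in M. P \<omega>) \<ge> 1 - \<delta>" "\<P>(\<omega> in M. Q \<omega>) \<ge> 1 - \<delta>" "\<delta> < 1"
  shows "\<P>(\<omega> in M. P \<omega> \<and> Q \<omega>) \<ge> 1 - 2 * \<delta>"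
proof -
  let ?A = "{\<omega> \<in> space M. P \<omega>}" and ?B = "{\<omega> \<in> space M. Q \<omega>}"
  have sets: "?A \<in> events" "?B \<in> events"
    using assms measure_notin_sets[of ?A M] measure_notin_sets[of ?B M] by fastforce+
  have "prob ?A - prob (?A \<inter> ?B) = prob (?A - ?B)"
    using sets by (simp add: finite_measure_Diff')
  also have "\<dots> \<le> prob (space M - ?B)"
    using sets by (intro finite_measure_mono) auto
  also have "\<dots> = 1 - prob ?B"
    using sets by (simp add: prob_compl)
  finally have "1 - 2 * \<delta> \<le> prob (?A \<inter> ?B)" using assms by linarith
  also have "?A \<inter> ?B = {\<omega> \<in> space M. P \<omega> \<and> Q \<omega>}" by auto
  finally show ?thesis .
qed

text \<open>Since \<open>\<kappa> \<ge> exp 1\<close>, the logarithm is at least 1, so raising the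
  exponent can only increase the factor.\<close>

lemma hidden_factor_le:
  assumes "0 \<le> c" "c \<le> d" "p \<le> q" "exp 1 \<le> \<kappa>" "1 \<le> t" "t \<le> T"
  shows "hidden_factor c p \<kappa> t \<le> hidden_factor d q \<kappa> T"
proof -
  have "0 < \<kappa>" using assms(4) exp_gt_zero[of "1::real"] by linarith
  have "exp 1 \<le> \<kappa> * real t"
    using assms(4,5) mult_mono[of "exp 1" \<kappa> 1 "real t"] \<open>0 < \<kappa>\<close> by simp
  then have 1: "1 \<le> ln (\<kappa> * real t)"
    using ln_mono[of "exp 1" "\<kappa> * real t"] by simp
  have 2: "ln (\<kappa> * real t) \<le> ln (\<kappa> * real T)"
    using assms(5,6) \<open>0 < \<kappa>\<close> by (intro ln_mono) auto
  have "ln (\<kappa> * real t) ^ p \<le> ln (\<kappa> * real T) ^ p"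
    using 1 2 by (intro power_mono) auto
  also have "\<dots> \<le> ln (\<kappa> * real T) ^ q"
    using 1 2 assms(3) by (intro power_increasing) auto
  finally show ?thesis
    unfolding hidden_factor_def using assms 1 2 by (intro mult_mono) auto
qed

lemma hidden_factor_ge:
  assumes "0 \<le> c" "exp 1 \<le> \<kappa>" "1 \<le> t"
  shows "c \<le> hidden_factor c p \<kappa> t"
  using hidden_factor_le[of c c 0 p \<kappa> t t] assms by (simp add: hidden_factor_def)

text \<open>The constants \<open>c\<close> and \<open>p\<close> are chosen before the problem and
  depend only on \<open>c1\<close>, \<open>c2\<close>, \<open>p1\<close>, \<open>p2\<close>. If both
  input bounds hold on a common event of probability \<open>1 - \<delta>\<close>, LCBCE inherits
  this level; two separate events cost a second \<open>\<delta>\<close> through the union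
  bound.\<close>

theorem theorem3:
  fixes c1 c2 :: real and p1 p2 :: nat
  assumes "c1 > 0" and "c2 > 0"
  shows "\<exists>c>0. \<exists>p.
    \<forall>(M :: ('s, 'a) mdp) (\<AA> :: ('u, 's, 'a) algorithm) lcb \<pi>0 \<alpha> \<delta> C \<kappa>
      (\<Omega> :: 'w measure) U X (\<Omega>' :: 'v measure) U' X'.
    let V0 = policy_value M \<pi>0;
        \<Delta>0 = opt_value M - V0;
        good_regret = (\<lambda>\<omega>. \<forall>T\<ge>1. regret M \<AA> U X T \<omega> \<le> hidden_factor c1 p1 \<kappa> T * (C * sqrt T));
        good_lcb = (\<lambda>\<omega>. \<forall>t\<ge>1. lcb_error M \<AA> lcb U X t \<omega> \<le> hidden_factor c2 p2 \<kappa> t * (C * sqrt t));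
        good_lcbce = (\<lambda>T \<omega>. regret M (lcbce \<AA> lcb \<pi>0 V0 \<alpha>) U' X' T \<omega> \<le>
          hidden_factor c p \<kappa> T * (C * sqrt T + C\<^sup>2 * \<Delta>0 / (\<alpha> * V0 * (\<alpha> * V0 + \<Delta>0))))
    in
      is_mdp M \<and> \<pi>0 \<in> policies M \<and> 0 < \<alpha> \<and> \<alpha> < 1 \<and> 0 < \<alpha> * V0 \<and>
      0 < \<delta> \<and> \<delta> < 1 \<and> exp 1 \<le> \<kappa> \<and>
      is_algorithm M \<AA> \<and> computable_bounds M \<AA> lcb \<and>
      is_run M \<AA> \<Omega> U X \<and> is_run M (lcbce \<AA> lcb \<pi>0 V0 \<alpha>) \<Omega>' U' X' \<and>
      (\<forall>t\<ge>1. \<P>(\<omega> in \<Omega>. \<forall>k\<in>{1..t}.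
        lcb (U \<omega>) (observed X t \<omega>) k \<le> policy_value M (played \<AA> U X k \<omega>)) \<ge> 1 - \<delta>) \<and>
      \<P>(\<omega> in \<Omega>. good_regret \<omega>) \<ge> 1 - \<delta> \<and>
      \<P>(\<omega> in \<Omega>. good_lcb \<omega>) \<ge> 1 - \<delta>
      \<longrightarrow>
      (\<forall>T\<ge>1.
        (\<P>(\<omega> in \<Omega>. good_regret \<omega> \<and> good_lcb \<omega>) \<ge> 1 - \<delta>
          \<longrightarrow> \<P>(\<omega> in \<Omega>'. good_lcbce T \<omega>) \<ge> 1 - \<delta>) \<and>
        \<P>(\<omega> in \<Omega>'. good_lcbce T \<omega>) \<ge> 1 - 2 * \<delta>)"
proof -
  \<comment> \<open>With \<open>K = Q * C\<close>, where \<open>Q\<close> has constant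
    \<open>c1 + c2\<close> and exponent \<open>p1 + p2\<close>, the deterministic bound carries the
    factors \<open>2 * Q\<close> and \<open>Q\<^sup>2\<close>; \<open>c\<close> and \<open>p\<close>
    dominate both.\<close>
  define c where "c = 2 * (c1 + c2) + (c1 + c2)\<^sup>2"
  define p where "p = 2 * (p1 + p2)"
  have "0 < c" using assms by (simp add: c_def add_pos_nonneg)
  have main: "\<P>(\<omega> in \<Omega>. (\<forall>T\<ge>1. regret M \<AA> U X T \<omega> \<le> hidden_factor c1 p1 \<kappa> T * (C * sqrt T)) \<and>
        (\<forall>t\<ge>1. lcb_error M \<AA> lcb U X t \<omega> \<le> hidden_factor c2 p2 \<kappa> t * (C * sqrt t)))
      \<le> \<P>(\<omega> in \<Omega>'. regret M (lcbce \<AA> lcb \<pi>0 (policy_value M \<pi>0) \<alpha>) U' X' T \<omega> \<le>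
          hidden_factor c p \<kappa> T * (C * sqrt T + C\<^sup>2 * (opt_value M - policy_value M \<pi>0) /
            (\<alpha> * policy_value M \<pi>0 * (\<alpha> * policy_value M \<pi>0 + (opt_value M - policy_value M \<pi>0)))))"
    if M: "is_mdp M" and \<AA>: "is_algorithm M \<AA>" and \<pi>0: "\<pi>0 \<in> policies M"
      and lcb: "computable_bounds M \<AA> lcb" and V0: "0 < \<alpha> * policy_value M \<pi>0"
      and run: "is_run M \<AA> \<Omega> U X"
      and run': "is_run M (lcbce \<AA> lcb \<pi>0 (policy_value M \<pi>0) \<alpha>) \<Omega>' U' X'"
      and \<kappa>: "exp 1 \<le> \<kappa>" and T: "1 \<le> T" and \<delta>: "\<delta> < 1"
      and regret: "\<P>(\<omega> in \<Omega>. \<forall>T\<ge>1. regret M \<AA> U X T \<omega> \<le> hidden_factor c1 p1 \<kappa> T * (C * sqrt T)) \<ge> 1 - \<delta>"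
    for M :: "('s, 'a) mdp" and \<AA> :: "('u, 's, 'a) algorithm" and lcb \<pi>0 \<alpha> \<delta> C \<kappa> T
      and \<Omega> :: "'w measure" and U X and \<Omega>' :: "'v measure" and U' X'
  proof -
    \<comment> \<open>The sign of \<open>C\<close> is derived: the good regret event has positive
      probability, and at any of its points the nonnegative regret of the first episode is at most a
      positive multiple of \<open>C\<close>.\<close>
    have "{\<omega> \<in> space \<Omega>. \<forall>T\<ge>1. regret M \<AA> U X T \<omega> \<le> hidden_factor c1 p1 \<kappa> T * (C * sqrt T)} \<noteq> {}"
      using regret \<delta> by (auto simp del: Collect_empty_eq)
    then obtain \<omega> where \<omega>: "\<omega> \<in> space \<Omega>"
      "regret M \<AA> U X 1 \<omega> \<le> hidden_factor c1 p1 \<kappa> 1 * (C * sqrt (real 1))" by blast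
    have "select \<AA> (U \<omega>) [] \<in> policies M"
      using is_run_space(1)[OF run \<omega>(1)] by (intro select_in_policies[OF \<AA>]) auto
    then have "0 \<le> regret M \<AA> U X 1 \<omega>"
      using policy_value_le_opt_value[OF M] by (simp add: regret_def played_def observed_def)
    then have "0 \<le> hidden_factor c1 p1 \<kappa> 1 * C" using \<omega>(2) by simp
    moreover have "0 < hidden_factor c1 p1 \<kappa> 1"
      using hidden_factor_ge[of c1 \<kappa> 1 p1] \<kappa> assms by simp
    ultimately have C: "0 \<le> C" by (simp add: zero_le_mult_iff)
    \<comment> \<open>One factor for all times up to \<open>T\<close>, dominating the hidden regret
      factor as well as the sum of both hidden factors.\<close>
    define Q where "Q = hidden_factor (c1 + c2) (p1 + p2) \<kappa> T"
    have Q: "0 \<le> Q" using hidden_factor_ge[of "c1 + c2" \<kappa> T "p1 + p2"] \<kappa> T assms by (simp add: Q_def)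
    have h1: "hidden_factor c1 p1 \<kappa> t \<le> Q" if "1 \<le> t" "t \<le> T" for t
      unfolding Q_def using that \<kappa> assms by (intro hidden_factor_le) auto
    have h12: "hidden_factor c1 p1 \<kappa> t + hidden_factor c2 p2 \<kappa> t \<le> Q" if "1 \<le> t" "t \<le> T" for t
    proof -
      have "hidden_factor c1 p1 \<kappa> t + hidden_factor c2 p2 \<kappa> t \<le>
          hidden_factor c1 (p1 + p2) \<kappa> T + hidden_factor c2 (p1 + p2) \<kappa> T"
        using that \<kappa> assms by (intro add_mono hidden_factor_le) auto
      then show ?thesis by (simp add: Q_def hidden_factor_def distrib_right)
    qed
    have "2 * Q = hidden_factor (2 * (c1 + c2)) (p1 + p2) \<kappa> T"
      unfolding Q_def hidden_factor_def by (simp only: mult.assoc)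
    also have "\<dots> \<le> hidden_factor (2 * (c1 + c2)) p \<kappa> T"
      using \<kappa> T assms by (intro hidden_factor_le) (auto simp: p_def)
    finally have "2 * Q \<le> hidden_factor (2 * (c1 + c2)) p \<kappa> T" .
    moreover have "Q\<^sup>2 = hidden_factor ((c1 + c2)\<^sup>2) p \<kappa> T"
      by (simp add: Q_def hidden_factor_def p_def power_mult_distrib power_mult[symmetric] mult.commute)
    ultimately have "2 * Q + Q\<^sup>2 \<le> hidden_factor c p \<kappa> T"
      by (simp add: c_def hidden_factor_def distrib_right)
    then have Q_le: "2 * Q \<le> hidden_factor c p \<kappa> T" "Q\<^sup>2 \<le> hidden_factor c p \<kappa> T"
      using Q zero_le_power2[of Q] by linarith+
    define \<Delta> where "\<Delta> = opt_value M - policy_value M \<pi>0"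
    define D where "D = \<Delta> / (\<alpha> * policy_value M \<pi>0 * (\<alpha> * policy_value M \<pi>0 + \<Delta>))"
    have "0 \<le> \<Delta>" using policy_value_le_opt_value[OF M \<pi>0] by (simp add: \<Delta>_def)
    then have D: "0 \<le> D" using V0 by (simp add: D_def)
    have "2 * (Q * C) * sqrt T + (Q * C)\<^sup>2 * D = 2 * Q * (C * sqrt T) + Q\<^sup>2 * (C\<^sup>2 * D)"
      by (simp add: power_mult_distrib)
    also have "\<dots> \<le> hidden_factor c p \<kappa> T * (C * sqrt T) + hidden_factor c p \<kappa> T * (C\<^sup>2 * D)"
      using C D by (intro add_mono mult_right_mono Q_le) auto
    finally have R: "2 * (Q * C) * sqrt T + (Q * C)\<^sup>2 * \<Delta> / (\<alpha> * policy_value M \<pi>0 * (\<alpha> * policy_value M \<pi>0 + \<Delta>))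
        \<le> hidden_factor c p \<kappa> T * (C * sqrt T + C\<^sup>2 * \<Delta> / (\<alpha> * policy_value M \<pi>0 * (\<alpha> * policy_value M \<pi>0 + \<Delta>)))"
      by (simp add: D_def distrib_left)
    show ?thesis
    proof (rule prob_regret_lcbce[OF refl M \<AA> \<pi>0 lcb V0 run run' _ _ _ R[unfolded \<Delta>_def]])
      show "0 \<le> Q * C" using Q C by simp
      fix t assume t: "1 \<le> t" "t \<le> T"
      show "hidden_factor c1 p1 \<kappa> t * (C * sqrt t) \<le> Q * C * sqrt t"
        using mult_right_mono[OF h1[OF t], of "C * sqrt t"] C by (simp add: mult.assoc)
      show "hidden_factor c1 p1 \<kappa> t * (C * sqrt t) + hidden_factor c2 p2 \<kappa> t * (C * sqrt t) \<le> Q * C * sqrt t"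
        using mult_right_mono[OF h12[OF t], of "C * sqrt t"] C by (simp add: mult.assoc distrib_right)
    qed
  qed
  show ?thesis
  proof (intro exI[of _ c] conjI[OF \<open>0 < c\<close>] exI[of _ p] allI, unfold Let_def,
      intro impI, elim conjE, intro allI impI conjI, goal_cases)
    case (1 M \<AA> lcb \<pi>0 \<alpha> \<delta> C \<kappa> \<Omega> U X \<Omega>' U' X' T)
    show ?case
      by (rule order_trans[OF _ main]) (rule 1)+
  next
    case (2 M \<AA> lcb \<pi>0 \<alpha> \<delta> C \<kappa> \<Omega> U X \<Omega>' U' X' T)
    interpret prob_space \<Omega> using \<open>is_run M \<AA> \<Omega> U X\<close> by (simp add: is_run_def)
    show ?case
      by (rule order_trans[OF prob_conj_ge main]) (rule 2)+
  qed
qed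

end
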